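(* Let $c\in\mathbb{R}$. There exists a stationary solution, i.e. a smooth closed immersed planar curve $\gamma:\mathbb{S}^1\to\mathbb{R}^2$ satisfying $k_{ss}+ck^3\equiv 0$, if and only if either $$c=0,\qquad\text{or}\qquad c=c_j:=\frac{2}{(4j-1)^2}\quad\text{for some integer } j\ge 1.$$ If $c=0$, the only stationary solutions are round circles, possibly multiply covered. If $c=c_j$, the stationary solution is a unique super-lemniscate (the one with parameter $c_j$), up to similar transformations, reparametrisations, and multiple coverings.
   Context: For a smooth immersed closed planar curve $\gamma:\mathbb{S}^1\to\mathbb{R}^2$, $s$ denotes arclength, $T=\gamma_s$ the unit tangent, $N$ the unit normal obtained by rotating $T$ by $\pi/2$ counterclockwise, and $k=\langle\gamma_{ss},N\rangle$ the curvature. The critical curve diffusion flow with parameter $c$ is $\partial_t\gamma=-(k_{ss}+ck^3)N$; its stationary solutions (always understood to be closed curves) are those with $k_{ss}+ck^3\equiv0$. For $m\in(0,1)$ let $F(x;m)=\int_0^x\frac{d\theta}{\sqrt{1-m\sin^2\theta}}$, let $\operatorname{am}(\cdot;m)$ be the inverse function of $F(\cdot;m)$, and $\operatorname{cn}(x;m)=\cos(\operatorname{am}(x;m))$. A closed curve $\gamma:\mathbb{S}^1\to\mathbb{R}^2$ is called a super-lemniscate if, up to rescaling and reparametrisation, its curvature as a function of arclength is $k(s)=\frac{1}{\sqrt c}\operatorname{cn}\left(s;\frac12\right)$ with $c=c_j=\frac{2}{(4j-1)^2}$ for some integer $j\ge1$. *)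

theory Defs
  imports "HOL-Analysis.Analysis"
begin

text \<open>
  The plane is the type \<open>complex\<close>, with its Euclidean inner product; rotation by \<open>pi / 2\<close>
  counterclockwise is multiplication by \<open>\<i>\<close>. The circle is the real line modulo \<open>2 * pi\<close>, so a
  closed curve is a \<open>2 * pi\<close>-periodic map on the line.
\<close>

definition smooth :: "(real \<Rightarrow> 'a::real_normed_vector) \<Rightarrow> bool" where
  "smooth f \<longleftrightarrow> (\<forall>n t. ((\<lambda>g t. vector_derivative g (at t)) ^^ n) f differentiable (at t))"

definition immersed :: "(real \<Rightarrow> complex) \<Rightarrow> bool" where
  "immersed \<gamma> \<longleftrightarrow> smooth \<gamma> \<and> (\<forall>t. vector_derivative \<gamma> (at t) \<noteq> 0)"

definition closed_immersed :: "(real \<Rightarrow> complex) \<Rightarrow> bool" where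
  "closed_immersed \<gamma> \<longleftrightarrow> immersed \<gamma> \<and> (\<forall>t. \<gamma> (t + 2 * pi) = \<gamma> t)"

text \<open>Differentiation with respect to the arclength of \<open>\<gamma>\<close>, of a function \<open>f\<close> of the curve
  parameter.\<close>

definition arc_deriv ::
  "(real \<Rightarrow> complex) \<Rightarrow> (real \<Rightarrow> 'a::real_normed_vector) \<Rightarrow> real \<Rightarrow> 'a" where
  "arc_deriv \<gamma> f t = vector_derivative f (at t) /\<^sub>R norm (vector_derivative \<gamma> (at t))"

definition tangent :: "(real \<Rightarrow> complex) \<Rightarrow> real \<Rightarrow> complex" where
  "tangent \<gamma> = arc_deriv \<gamma> \<gamma>"

definition normal :: "(real \<Rightarrow> complex) \<Rightarrow> real \<Rightarrow> complex" where
  "normal \<gamma> t = \<i> * tangent \<gamma> t"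

definition curvature :: "(real \<Rightarrow> complex) \<Rightarrow> real \<Rightarrow> real" where
  "curvature \<gamma> t = arc_deriv \<gamma> (tangent \<gamma>) t \<bullet> normal \<gamma> t"

definition stationary :: "real \<Rightarrow> (real \<Rightarrow> complex) \<Rightarrow> bool" where
  "stationary c \<gamma> \<longleftrightarrow> closed_immersed \<gamma> \<and>
     (\<forall>t. arc_deriv \<gamma> (arc_deriv \<gamma> (curvature \<gamma>)) t + c * curvature \<gamma> t ^ 3 = 0)"

text \<open>The interval integral is oriented, so \<open>ell_F\<close> is odd in \<open>x\<close>. For \<open>0 < m < 1\<close> it is a bijection
  of the real line, and \<open>am\<close> is its genuine inverse.\<close>

definition ell_F :: "real \<Rightarrow> real \<Rightarrow> real" where
  "ell_F x m = (LBINT \<theta>=ereal 0..ereal x. 1 / sqrt (1 - m * (sin \<theta>)\<^sup>2))"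

definition am :: "real \<Rightarrow> real \<Rightarrow> real" where
  "am x m = inv (\<lambda>\<theta>. ell_F \<theta> m) x"

definition cn :: "real \<Rightarrow> real \<Rightarrow> real" where
  "cn x m = cos (am x m)"

definition c_crit :: "nat \<Rightarrow> real" where
  "c_crit j = 2 / (4 * real j - 1)\<^sup>2"

definition line_diffeo :: "(real \<Rightarrow> real) \<Rightarrow> bool" where
  "line_diffeo \<phi> \<longleftrightarrow> smooth \<phi> \<and> (\<forall>t. vector_derivative \<phi> (at t) \<noteq> 0) \<and> bij \<phi>"

text \<open>The rescaled and reparametrised curve \<open>\<lambda>s. r *\<^sub>R \<gamma> (\<phi> s)\<close> is parametrised by arclength on the
  whole line, hence no longer \<open>2 * pi\<close>-periodic; the closed curve is \<open>\<gamma>\<close>. Multiple covers count.\<close>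

definition super_lemniscate :: "nat \<Rightarrow> (real \<Rightarrow> complex) \<Rightarrow> bool" where
  "super_lemniscate j \<gamma> \<longleftrightarrow> closed_immersed \<gamma> \<and>
     (\<exists>r \<phi>. r > 0 \<and> line_diffeo \<phi> \<and>
        (\<forall>s. norm (vector_derivative (\<lambda>s. r *\<^sub>R \<gamma> (\<phi> s)) (at s)) = 1 \<and>
             curvature (\<lambda>s. r *\<^sub>R \<gamma> (\<phi> s)) s = 1 / sqrt (c_crit j) * cn s (1 / 2)))"

text \<open>Lifts to the line of the diffeomorphisms of the circle, of either orientation.\<close>

definition circle_diffeo :: "(real \<Rightarrow> real) \<Rightarrow> bool" where
  "circle_diffeo \<psi> \<longleftrightarrow> smooth \<psi> \<and> (\<forall>t. vector_derivative \<psi> (at t) \<noteq> 0) \<and>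
     ((\<forall>t. \<psi> (t + 2 * pi) = \<psi> t + 2 * pi) \<or> (\<forall>t. \<psi> (t + 2 * pi) = \<psi> t - 2 * pi))"

text \<open>\<open>\<gamma>\<close> is \<open>\<gamma>\<^sub>0\<close> traversed \<open>n\<close> times, up to reparametrisation.\<close>

definition multiple_cover :: "(real \<Rightarrow> complex) \<Rightarrow> (real \<Rightarrow> complex) \<Rightarrow> bool" where
  "multiple_cover \<gamma>\<^sub>0 \<gamma> \<longleftrightarrow>
     (\<exists>(n::nat) \<psi>. n \<ge> 1 \<and> circle_diffeo \<psi> \<and> \<gamma> = (\<lambda>t. \<gamma>\<^sub>0 (real n * \<psi> t)))"

definition similarity :: "(complex \<Rightarrow> complex) \<Rightarrow> bool" where
  "similarity S \<longleftrightarrow> (\<exists>r f b. r > 0 \<and> orthogonal_transformation f \<and> S = (\<lambda>z. r *\<^sub>R f z + b))"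

definition round_circle :: "complex \<Rightarrow> real \<Rightarrow> real \<Rightarrow> complex" where
  "round_circle p r t = p + r *\<^sub>R cis t"

end

theory Submission
  imports Defs
begin

text \<open>
  In arclength, \<open>k\<^sub>s\<^sub>s + c * k\<^sup>3 = 0\<close> for a closed curve forces \<open>k\<close> to be a nonzero constant when
  \<open>c \<le> 0\<close>, because \<open>k * k\<^sub>s\<close> is periodic with derivative \<open>k\<^sub>s\<^sup>2 - c * k\<^sup>4 \<ge> 0\<close>; hence \<open>c = 0\<close> and the
  curve is a circle. When \<open>c > 0\<close>, uniqueness for \<open>x'' = - x\<^sup>3\<close> gives
  \<open>k s = A / sqrt c * cn (A * s + b)\<close>. The function \<open>\<phi> = 2 * arcsin (sn / sqrt 2)\<close> satisfies
  \<open>\<phi>' = sqrt 2 * cn\<close>, \<open>cos \<phi> = cn\<^sup>2\<close>, \<open>sin \<phi> = sqrt 2 * sn * dn\<close>, so the tangent is a constant multiple of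
  \<open>exp (i * a * \<phi>)\<close> with \<open>a = 1 / sqrt (2 * c)\<close>, and the curve closes up if and only if the integral
  \<open>G a = elastica a cn_period\<close> of \<open>exp (i * a * \<phi>)\<close> over a period of \<open>cn\<close> vanishes. Integrating the derivative of
  \<open>cn * exp (i * b * \<phi>)\<close> yields \<open>(2 * b + 1) * G (b + 1) + (2 * b - 1) * G (b - 1) = 0\<close>. As
  \<open>\<bar>\<phi>\<bar> \<le> pi / 2\<close>, \<open>G a\<close> has positive real part for \<open>\<bar>a\<bar> \<le> 1\<close>, so the zeros of \<open>G\<close> with \<open>a \<ge> 0\<close> are
  exactly \<open>a = (4 * j - 1) / 2\<close>, that is \<open>c = c_crit j\<close>.
\<close>

subsection \<open>Smooth functions on the line\<close>

text \<open>A finite-order form of \<open>smooth\<close> suited to induction: the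
  order-\<open>n + 1\<close> product, chain and quotient rules produce derivatives built from
  \<open>f\<close>, \<open>g\<close> and their derivatives, all of order \<open>n\<close>. Recursion
  peels off the innermost derivative, whereas \<open>smooth\<close> iterates an operator.\<close>

primrec diff_n :: "nat \<Rightarrow> (real \<Rightarrow> 'a::real_normed_vector) \<Rightarrow> bool" where
  "diff_n 0 f \<longleftrightarrow> True"
| "diff_n (Suc n) f \<longleftrightarrow>
     (\<forall>t. f differentiable (at t)) \<and> diff_n n (\<lambda>t. vector_derivative f (at t))"

lemma smooth_iff_diff_n: "smooth f \<longleftrightarrow> (\<forall>n. diff_n n f)"
proof -
  let ?D = "\<lambda>g t. vector_derivative g (at t)"
  have "diff_n n f \<longleftrightarrow> (\<forall>m<n. \<forall>t. (?D ^^ m) f differentiable (at t))" for n and f :: "real \<Rightarrow> 'a"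
  proof (induction n arbitrary: f)
    case (Suc n)
    have "(\<forall>m<Suc n. \<forall>t. (?D ^^ m) f differentiable (at t)) \<longleftrightarrow>
      (\<forall>t. f differentiable (at t)) \<and> (\<forall>m<n. \<forall>t. (?D ^^ m) (?D f) differentiable (at t))"
      by (simp add: All_less_Suc2 funpow_Suc_right del: funpow.simps)
    then show ?case using Suc.IH[of "?D f"] by simp
  qed simp
  then show ?thesis unfolding smooth_def by blast
qed

lemma diff_n_SucI:
  assumes "\<And>t. (f has_vector_derivative g t) (at t)" "diff_n n g"
  shows "diff_n (Suc n) f"
proof -
  have "(\<lambda>t. vector_derivative f (at t)) = g"
    using assms(1) by (auto simp: vector_derivative_at)
  then show ?thesis using assms by (auto intro: differentiableI_vector)
qed

lemma diff_n_SucE: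
  assumes "diff_n (Suc n) f"
  obtains g where "\<And>t. (f has_vector_derivative g t) (at t)" "diff_n n g"
  using assms that[of "\<lambda>t. vector_derivative f (at t)"]
  by (auto simp: vector_derivative_works)

lemma diff_n_SucD: "diff_n (Suc n) f \<Longrightarrow> diff_n n f"
  by (induction n arbitrary: f) (auto elim!: diff_n_SucE)

lemma diff_n_const: "diff_n n (\<lambda>t. c)"
proof (induction n arbitrary: c)
  case (Suc n) show ?case by (rule diff_n_SucI[OF _ Suc[of 0]]) (auto intro!: derivative_eq_intros)
qed simp

lemma diff_n_id: "diff_n n (\<lambda>t. t)"
proof (cases n)
  case (Suc m)
  show ?thesis unfolding Suc
    by (rule diff_n_SucI[OF _ diff_n_const[of m 1]]) (auto intro!: derivative_eq_intros)
qed simp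

lemma diff_n_add: "diff_n n f \<Longrightarrow> diff_n n g \<Longrightarrow> diff_n n (\<lambda>t. f t + g t)"
proof (induction n arbitrary: f g)
  case (Suc n)
  then obtain f' g' where "\<And>t. (f has_vector_derivative f' t) (at t)" "diff_n n f'"
    "\<And>t. (g has_vector_derivative g' t) (at t)" "diff_n n g'" by (metis diff_n_SucE)
  then show ?case
    by (intro diff_n_SucI[of _ "\<lambda>t. f' t + g' t"] Suc.IH) (auto intro!: derivative_eq_intros)
qed simp

lemma diff_n_bilinear:
  assumes "bounded_bilinear h"
  shows "diff_n n f \<Longrightarrow> diff_n n g \<Longrightarrow> diff_n n (\<lambda>t. h (f t) (g t))"
proof (induction n arbitrary: f g)
  case (Suc n)
  obtain f' g' where d: "\<And>t. (f has_vector_derivative f' t) (at t)" "diff_n n f'"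
    "\<And>t. (g has_vector_derivative g' t) (at t)" "diff_n n g'" using Suc.prems by (metis diff_n_SucE)
  show ?case
    using d bounded_bilinear.has_vector_derivative[OF assms d(1) d(3)]
      Suc.prems[THEN diff_n_SucD]
    by (intro diff_n_SucI[of _ "\<lambda>t. h (f t) (g' t) + h (f' t) (g t)"] diff_n_add Suc.IH) auto
qed simp

lemma diff_n_linear:
  assumes "bounded_linear h"
  shows "diff_n n f \<Longrightarrow> diff_n n (\<lambda>t. h (f t))"
proof (induction n arbitrary: f)
  case (Suc n)
  then obtain f' where "\<And>t. (f has_vector_derivative f' t) (at t)" "diff_n n f'"
    by (metis diff_n_SucE)
  then show ?case
    using bounded_linear.has_vector_derivative[OF assms]
    by (intro diff_n_SucI[of _ "\<lambda>t. h (f' t)"] Suc.IH) auto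
qed simp

lemma diff_n_compose:
  fixes f :: "real \<Rightarrow> 'a::real_normed_vector"
  shows "diff_n n f \<Longrightarrow> diff_n n g \<Longrightarrow> diff_n n (\<lambda>t. f (g t))"
proof (induction n arbitrary: f g)
  case (Suc n)
  obtain f' g' where d: "\<And>t. (f has_vector_derivative f' t) (at t)" "diff_n n f'"
    "\<And>t. (g has_vector_derivative g' t) (at t)" "diff_n n g'" using Suc.prems by (metis diff_n_SucE)
  have "((\<lambda>t. f (g t)) has_vector_derivative g' t *\<^sub>R f' (g t)) (at t)" for t
    using vector_diff_chain_at[OF d(3) d(1)] by (simp add: o_def)
  then show ?case
    using d Suc.prems[THEN diff_n_SucD]
    by (intro diff_n_SucI[of _ "\<lambda>t. g' t *\<^sub>R f' (g t)"]
        diff_n_bilinear[OF bounded_bilinear_scaleR] Suc.IH[of f' g]) auto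
qed simp

text \<open>The derivative of \<open>1 / f\<close> is written through \<open>inverse (f t)\<close>
  itself, so the induction hypothesis covers it. \<open>diff_n_sqrt\<close> uses the same device
  with \<open>f' / (2 * sqrt f)\<close>.\<close>

lemma diff_n_inverse:
  fixes f :: "real \<Rightarrow> real"
  assumes "\<And>t. f t \<noteq> 0"
  shows "diff_n n f \<Longrightarrow> diff_n n (\<lambda>t. inverse (f t))"
proof (induction n)
  case (Suc n)
  obtain f' where d: "\<And>t. (f has_vector_derivative f' t) (at t)" "diff_n n f'"
    using Suc.prems by (metis diff_n_SucE)
  have "((\<lambda>t. inverse (f t)) has_vector_derivative - (inverse (f t) * (f' t * inverse (f t)))) (at t)"
    for t
    using d(1)[of t] assms[of t]
    by (auto simp: has_real_derivative_iff_has_vector_derivative[symmetric]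
        intro!: derivative_eq_intros)
  moreover have "diff_n n (\<lambda>t. - (inverse (f t) * (f' t * inverse (f t))))"
    by (intro diff_n_linear[OF bounded_linear_minus[OF bounded_linear_ident]]
        diff_n_bilinear[OF bounded_bilinear_mult] d Suc diff_n_SucD[OF Suc.prems])
  ultimately show ?case by (rule diff_n_SucI)
qed simp

lemma diff_n_sqrt:
  fixes f :: "real \<Rightarrow> real"
  assumes "\<And>t. f t > 0"
  shows "diff_n n f \<Longrightarrow> diff_n n (\<lambda>t. sqrt (f t))"
proof (induction n)
  case (Suc n)
  obtain f' where d: "\<And>t. (f has_vector_derivative f' t) (at t)" "diff_n n f'"
    using Suc.prems by (metis diff_n_SucE)
  have "((\<lambda>t. sqrt (f t)) has_vector_derivative f' t * (1/2 * inverse (sqrt (f t)))) (at t)" for t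
    using d(1)[of t] assms[of t]
    by (auto simp: has_real_derivative_iff_has_vector_derivative[symmetric]
        intro!: derivative_eq_intros)
  moreover have "diff_n n (\<lambda>t. f' t * (1/2 * inverse (sqrt (f t))))"
    using assms
    by (intro diff_n_bilinear[OF bounded_bilinear_mult] diff_n_const diff_n_inverse d Suc
        diff_n_SucD[OF Suc.prems]) (auto simp: less_imp_neq[symmetric])
  ultimately show ?case by (rule diff_n_SucI)
qed simp

lemma smoothI:
  assumes "\<And>t. (f has_vector_derivative g t) (at t)" "smooth g"
  shows "smooth f"
  using assms diff_n_SucI diff_n_SucD unfolding smooth_iff_diff_n by metis

lemma smooth_has_vector_derivative:
  "smooth f \<Longrightarrow> (f has_vector_derivative vector_derivative f (at t)) (at t)"
  unfolding smooth_iff_diff_n using diff_n.simps(2)[of 0 f] by (auto simp: vector_derivative_works)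

lemma smooth_vector_derivative: "smooth f \<Longrightarrow> smooth (\<lambda>t. vector_derivative f (at t))"
  unfolding smooth_iff_diff_n using diff_n.simps(2) by blast

text \<open>Bootstrapping: if \<open>y\<close> is \<open>n\<close> times differentiable, so is
  \<open>h (y t)\<close>, which is the derivative of \<open>y\<close>. It serves for inverse
  functions and for \<open>am\<close>, both of which solve such an equation.\<close>

lemma smooth_autonomous_ode:
  assumes "\<And>t. (y has_vector_derivative h (y t)) (at t)" "smooth h"
  shows "smooth y"
  unfolding smooth_iff_diff_n
proof
  show "diff_n n y" for n
  proof (induction n)
    case (Suc n)
    then show ?case
      using assms(2) unfolding smooth_iff_diff_n
      by (intro diff_n_SucI[OF assms(1)] diff_n_compose[of n h y]) auto
  qed simp
qed

named_theorems smooth_intros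

lemma smooth_const [smooth_intros]: "smooth (\<lambda>t. c)"
  by (simp add: smooth_iff_diff_n diff_n_const)

lemma smooth_id [smooth_intros]: "smooth (\<lambda>t. t)"
  by (simp add: smooth_iff_diff_n diff_n_id)

lemma smooth_add [smooth_intros]: "smooth f \<Longrightarrow> smooth g \<Longrightarrow> smooth (\<lambda>t. f t + g t)"
  by (simp add: smooth_iff_diff_n diff_n_add)

lemma smooth_linear: "bounded_linear h \<Longrightarrow> smooth f \<Longrightarrow> smooth (\<lambda>t. h (f t))"
  by (simp add: smooth_iff_diff_n diff_n_linear)

lemma smooth_minus [smooth_intros]: "smooth f \<Longrightarrow> smooth (\<lambda>t. - f t)"
  by (rule smooth_linear[OF bounded_linear_minus[OF bounded_linear_ident]])

lemma smooth_diff [smooth_intros]: "smooth f \<Longrightarrow> smooth g \<Longrightarrow> smooth (\<lambda>t. f t - g t)"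
  using smooth_add[of f "\<lambda>t. - g t"] smooth_minus[of g] by simp

lemma smooth_bilinear:
  "bounded_bilinear h \<Longrightarrow> smooth f \<Longrightarrow> smooth g \<Longrightarrow> smooth (\<lambda>t. h (f t) (g t))"
  by (simp add: smooth_iff_diff_n diff_n_bilinear)

lemmas smooth_mult [smooth_intros] = smooth_bilinear[OF bounded_bilinear_mult]
lemmas smooth_scaleR [smooth_intros] = smooth_bilinear[OF bounded_bilinear_scaleR]
lemmas smooth_inner [smooth_intros] = smooth_bilinear[OF bounded_bilinear_inner]

lemma smooth_compose: "smooth f \<Longrightarrow> smooth g \<Longrightarrow> smooth (\<lambda>t. f (g t))"
  by (simp add: smooth_iff_diff_n diff_n_compose)

lemma smooth_inverse [smooth_intros]:
  fixes f :: "real \<Rightarrow> real"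
  shows "smooth f \<Longrightarrow> (\<And>t. f t \<noteq> 0) \<Longrightarrow> smooth (\<lambda>t. inverse (f t))"
  by (simp add: smooth_iff_diff_n diff_n_inverse)

lemma smooth_sqrt [smooth_intros]: "smooth f \<Longrightarrow> (\<And>t. f t > 0) \<Longrightarrow> smooth (\<lambda>t. sqrt (f t))"
  by (simp add: smooth_iff_diff_n diff_n_sqrt)

lemma smooth_norm [smooth_intros]:
  fixes f :: "real \<Rightarrow> 'a::real_inner"
  assumes "smooth f" "\<And>t. f t \<noteq> 0"
  shows "smooth (\<lambda>t. norm (f t))"
  unfolding norm_eq_sqrt_inner using assms by (intro smooth_intros) auto

lemma smooth_cis: "smooth cis"
  unfolding smooth_iff_diff_n
proof
  have "(cis has_vector_derivative \<i> * cis t) (at t)" for t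
    using has_derivative_cis[of "\<lambda>x. x" "\<lambda>x. x" t UNIV] by (simp add: has_vector_derivative_def)
  then show "diff_n n cis" for n
    by (induction n) (auto intro!: diff_n_SucI diff_n_linear[OF bounded_linear_mult_right] simp del: diff_n.simps(2))
qed

section \<open>Quasi-periodic functions and diffeomorphisms of the line\<close>

lemma shift_of_int:
  fixes f :: "real \<Rightarrow> 'a::real_vector"
  assumes "\<And>t. f (t + p) = f t + q"
  shows "f (t + of_int n * p) = f t + of_int n *\<^sub>R q"
proof (induction n arbitrary: t rule: int_induct[of _ 0])
  case (step1 i)
  have "f (t + of_int (i + 1) * p) = f ((t + of_int i * p) + p)" by (simp add: algebra_simps)
  then show ?case using step1 by (simp only: assms) (simp add: algebra_simps)
next
  case (step2 i)
  have "f (t + of_int i * p) = f ((t + of_int (i - 1) * p) + p)" by (simp add: algebra_simps)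
  then show ?case using step2 by (simp only: assms) (simp add: algebra_simps)
qed simp

lemma has_vector_derivative_real: "(f has_vector_derivative f') F \<longleftrightarrow> (f has_real_derivative f') F"
  by (simp add: has_real_derivative_iff_has_vector_derivative)

text \<open>An increasing function gains the same \<open>q > 0\<close> over every period, so it is
  unbounded in both directions and the intermediate value theorem gives surjectivity. Applied to
  \<open>ell_F\<close>, to arclength, and to the parameter change of a stationary curve.\<close>

lemma bij_quasiperiodic:
  fixes f f' :: "real \<Rightarrow> real"
  assumes d: "\<And>t. (f has_real_derivative f' t) (at t)" "\<And>t. f' t > 0"
    and p: "p > 0" "\<And>t. f (t + p) = f t + q"
  shows "bij f" "strict_mono f" "q > 0"
proof -
  show m: "strict_mono f"
    by (rule strict_monoI, rule DERIV_pos_imp_increasing) (use d in blast)+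
  have "f 0 < f (0 + p)" using m p(1) by (auto simp: strict_mono_def)
  then show q: "q > 0" using p(2)[of 0] by simp
  have "y \<in> range f" for y
  proof -
    \<comment> \<open>Enough periods in each direction that the values at \<open>- n * p\<close> and
      \<open>n * p\<close> enclose \<open>y\<close>.\<close>
    obtain n :: nat where n: "\<bar>y - f 0\<bar> < real n * q"
      using reals_Archimedean3[OF q] by blast
    have "f (of_int (int n) * p) = f 0 + of_int (int n) * q" "f (of_int (- int n) * p) = f 0 - of_int (int n) * q"
      using shift_of_int[of f p q 0 "int n"] shift_of_int[of f p q 0 "- int n"] p(2) by simp_all
    moreover have "of_int (- int n) * p \<le> of_int (int n) * p" using p(1) by simp
    ultimately show ?thesis
      using IVT[of f "of_int (- int n) * p" y "of_int (int n) * p"] n DERIV_isCont[OF d(1)] by fastforce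
  qed
  then have "surj f" by blast
  then show "bij f" using strict_mono_imp_inj_on[OF m] by (auto simp: bij_def)
qed

lemma inv_has_real_derivative:
  fixes f :: "real \<Rightarrow> real"
  assumes d: "\<And>t. (f has_real_derivative f' t) (at t)" "\<And>t. f' t \<noteq> 0" and b: "bij f"
  shows "(inv f has_real_derivative inverse (f' (inv f x))) (at x)"
proof (rule DERIV_inverse_function[where f = f and a = "x - 1" and b = "x + 1"])
  have i: "inv f (f z) = z" for z using b by (simp add: bij_is_inj)
  have f: "f (inv f z) = z" for z using b by (simp add: bij_is_surj surj_f_inv_f)
  show "f (inv f y) = y" for y by (rule f)
  have "isCont (inv f) (f (inv f x))"
    by (rule isCont_inverse_function[of 1]) (simp_all add: i DERIV_isCont[OF d(1)])
  then show "isCont (inv f) x" by (simp add: f)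
qed (use d in simp_all)

lemma smooth_has_real_derivative:
  fixes f :: "real \<Rightarrow> real"
  shows "smooth f \<Longrightarrow> (f has_real_derivative vector_derivative f (at t)) (at t)"
  using smooth_has_vector_derivative[of f] by (simp add: has_vector_derivative_real)

lemma line_diffeo_inv:
  assumes "line_diffeo f"
  shows "line_diffeo (inv f)"
proof -
  let ?f' = "\<lambda>t. vector_derivative f (at t)"
  have f: "smooth f" "\<And>t. ?f' t \<noteq> 0" "bij f" using assms by (auto simp: line_diffeo_def)
  have d: "(inv f has_vector_derivative inverse (?f' (inv f t))) (at t)" for t
    using inv_has_real_derivative[OF smooth_has_real_derivative[OF f(1)] f(2,3)]
    by (simp add: has_vector_derivative_real)
  have "smooth (\<lambda>s. inverse (?f' s))"
    by (intro smooth_inverse smooth_vector_derivative f)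
  then have "smooth (inv f)"
    by (rule smooth_autonomous_ode[where h = "\<lambda>s. inverse (?f' s)", OF d])
  moreover have "vector_derivative (inv f) (at t) \<noteq> 0" for t
    unfolding vector_derivative_at[OF d] using f(2) by simp
  ultimately show ?thesis
    using f(3) by (simp add: line_diffeo_def bij_imp_bij_inv)
qed

text \<open>The range of the continuous derivative is connected and misses \<open>0\<close>. The
  sign \<open>\<sigma>\<close> records whether a reparametrisation preserves or reverses
  orientation.\<close>

lemma nonvanishing_derivative_sign:
  fixes f :: "real \<Rightarrow> real"
  assumes "smooth f" "\<And>t. vector_derivative f (at t) \<noteq> 0"
  obtains \<sigma> :: real where "\<sigma> = 1 \<or> \<sigma> = -1"
    "\<And>t. vector_derivative f (at t) = \<sigma> * \<bar>vector_derivative f (at t)\<bar>"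
proof -
  let ?g = "\<lambda>t. vector_derivative f (at t)"
  have c: "continuous_on UNIV ?g"
    using smooth_has_vector_derivative[OF smooth_vector_derivative[OF assms(1)]]
    by (intro continuous_at_imp_continuous_on) (auto intro: has_vector_derivative_continuous)
  have "connected (range ?g)" by (rule connected_continuous_image[OF c]) simp
  then have "\<not> (?g s < 0 \<and> 0 < ?g t)" for s t
    using assms(2) connectedD_interval[of "range ?g" "?g s" "?g t" 0] by fastforce
  then have "(\<forall>t. ?g t > 0) \<or> (\<forall>t. ?g t < 0)" using assms(2) by (metis not_less_iff_gr_or_eq)
  then show ?thesis
  proof
    assume "\<forall>t. ?g t > 0"
    then have "\<bar>?g t\<bar> = ?g t" for t by (meson abs_of_pos)
    then show ?thesis by (intro that[of 1]) simp_all
  next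
    assume "\<forall>t. ?g t < 0"
    then have "\<bar>?g t\<bar> = - ?g t" for t by (meson abs_of_neg)
    then show ?thesis by (intro that[of "-1"]) simp_all
  qed
qed

lemma antiderivative_exists:
  fixes f :: "real \<Rightarrow> 'a::euclidean_space"
  assumes "\<And>t. isCont f t"
  obtains F where "\<And>t. (F has_vector_derivative f t) (at t)"
  using einterval_antiderivative[of "-\<infinity>" \<infinity> f] assms by auto

lemma vector_derivative_zero_constant:
  fixes f :: "real \<Rightarrow> 'a::real_normed_vector"
  assumes "\<And>t. (f has_vector_derivative 0) (at t)"
  shows "f s = f t"
  using has_derivative_zero_constant[of UNIV f] assms by (auto simp: has_vector_derivative_def)

lemma same_derivative_shift:
  fixes f g :: "real \<Rightarrow> 'a::real_normed_vector"
  assumes "\<And>t. (f has_vector_derivative h t) (at t)" "\<And>t. (g has_vector_derivative h t) (at t)"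
  shows "f s - g s = f t - g t"
  by (rule vector_derivative_zero_constant) (use assms in \<open>auto intro!: derivative_eq_intros\<close>)

subsection \<open>Curvature under similarities and reparametrisations\<close>

text \<open>The Frenet equations in an arbitrary parameter, with speed \<open>v\<close>, unit
  tangent \<open>T\<close> and curvature \<open>k\<close>. Exhibiting such data determines
  \<open>tangent\<close> and \<open>curvature\<close> without unfolding nested arclength
  derivatives.\<close>

definition frenet where
  "frenet \<gamma> v T k \<longleftrightarrow> (\<forall>t. v t > 0 \<and> norm (T t) = 1 \<and>
     (\<gamma> has_vector_derivative v t *\<^sub>R T t) (at t) \<and>
     (T has_vector_derivative (v t * k t) *\<^sub>R (\<i> * T t)) (at t))"

lemma frenet_arc_deriv:
  assumes "frenet \<gamma> v T k" "(g has_vector_derivative v t *\<^sub>R g') (at t)"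
  shows "arc_deriv \<gamma> g t = g'"
proof -
  have "(\<gamma> has_vector_derivative v t *\<^sub>R T t) (at t)" "v t > 0" "norm (T t) = 1"
    using assms by (auto simp: frenet_def)
  then show ?thesis using assms(2) by (simp add: arc_deriv_def vector_derivative_at)
qed

lemma frenet_tangent: "frenet \<gamma> v T k \<Longrightarrow> tangent \<gamma> = T"
  unfolding tangent_def by (rule ext, rule frenet_arc_deriv, assumption) (auto simp: frenet_def)

lemma frenet_curvature:
  assumes "frenet \<gamma> v T k"
  shows "curvature \<gamma> = k"
proof
  fix t
  have "arc_deriv \<gamma> T t = k t *\<^sub>R (\<i> * T t)"
    using assms by (intro frenet_arc_deriv[OF assms]) (simp add: frenet_def)
  moreover have "(\<i> * T t) \<bullet> (\<i> * T t) = 1"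
    using assms by (simp add: frenet_def norm_mult flip: power2_norm_eq_inner)
  ultimately show "curvature \<gamma> t = k t"
    by (simp add: curvature_def normal_def frenet_tangent[OF assms])
qed

lemma smooth_arc_deriv: "immersed \<gamma> \<Longrightarrow> smooth g \<Longrightarrow> smooth (arc_deriv \<gamma> g)"
  unfolding arc_deriv_def[abs_def] immersed_def
  by (intro smooth_intros smooth_vector_derivative) auto

lemma immersed_smooth:
  assumes "immersed \<gamma>"
  shows "smooth (tangent \<gamma>)" "smooth (curvature \<gamma>)"
proof -
  show T: "smooth (tangent \<gamma>)"
    unfolding tangent_def using assms by (intro smooth_arc_deriv) (simp_all add: immersed_def)
  show "smooth (curvature \<gamma>)"
    unfolding curvature_def[abs_def] normal_def[abs_def]
    by (intro smooth_intros smooth_arc_deriv assms T)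
qed

text \<open>\<open>z\<close> and \<open>\<i> * z\<close> form an orthonormal basis of the plane, and
  the component along \<open>z\<close> vanishes.\<close>

lemma complex_orthogonal_decomposition:
  fixes z w :: complex
  assumes "norm z = 1" "w \<bullet> z = 0"
  shows "w = (w \<bullet> (\<i> * z)) *\<^sub>R (\<i> * z)"
proof -
  have z: "(Re z)\<^sup>2 + (Im z)\<^sup>2 = 1" using assms(1) by (metis cmod_power2 one_power2)
  have w: "Re w * Re z + Im w * Im z = 0" using assms(2) by (simp add: inner_complex_def)
  have "Re w = (- Re w * Im z + Im w * Re z) * (- Im z)" "Im w = (- Re w * Im z + Im w * Re z) * Re z"
    using z w by algebra+
  then show ?thesis by (simp add: complex_eq_iff inner_complex_def)
qed

lemma immersed_frenet:
  assumes "immersed \<gamma>"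
  shows "frenet \<gamma> (\<lambda>t. norm (vector_derivative \<gamma> (at t))) (tangent \<gamma>) (curvature \<gamma>)"
  unfolding frenet_def
proof (intro allI conjI)
  fix t
  let ?v = "norm (vector_derivative \<gamma> (at t))" and ?T' = "vector_derivative (tangent \<gamma>) (at t)"
  show v: "?v > 0" using assms by (simp add: immersed_def)
  have n: "norm (tangent \<gamma> t) = 1" for t
    using assms by (simp add: immersed_def tangent_def arc_deriv_def)
  then show "norm (tangent \<gamma> t) = 1" .
  have "?v *\<^sub>R tangent \<gamma> t = vector_derivative \<gamma> (at t)"
    using v by (simp add: tangent_def arc_deriv_def)
  then show "(\<gamma> has_vector_derivative ?v *\<^sub>R tangent \<gamma> t) (at t)"
    using assms by (simp add: immersed_def smooth_has_vector_derivative)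
  have T: "(tangent \<gamma> has_vector_derivative ?T') (at t)"
    by (intro smooth_has_vector_derivative immersed_smooth assms)
  \<comment> \<open>Differentiating the constant squared norm of the tangent shows that its
    derivative is orthogonal to it, hence a multiple of the normal.\<close>
  have "((\<lambda>t. tangent \<gamma> t \<bullet> tangent \<gamma> t) has_vector_derivative
      tangent \<gamma> t \<bullet> ?T' + ?T' \<bullet> tangent \<gamma> t) (at t)"
    by (rule bounded_bilinear.has_vector_derivative[OF bounded_bilinear_inner T T])
  moreover have "(\<lambda>t. tangent \<gamma> t \<bullet> tangent \<gamma> t) = (\<lambda>t. 1)"
    using n by (simp flip: power2_norm_eq_inner)
  ultimately have "((\<lambda>t. 1::real) has_vector_derivative
      tangent \<gamma> t \<bullet> ?T' + ?T' \<bullet> tangent \<gamma> t) (at t)" by simp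
  then have "tangent \<gamma> t \<bullet> ?T' + ?T' \<bullet> tangent \<gamma> t = 0"
    by (rule vector_derivative_unique_at[OF _ has_vector_derivative_const])
  then have "?T' \<bullet> tangent \<gamma> t = 0" by (simp add: inner_commute)
  from complex_orthogonal_decomposition[OF n this]
  have "?T' = (?T' \<bullet> (\<i> * tangent \<gamma> t)) *\<^sub>R (\<i> * tangent \<gamma> t)" .
  moreover have "?T' \<bullet> (\<i> * tangent \<gamma> t) = ?v * curvature \<gamma> t"
    using v by (simp add: curvature_def normal_def arc_deriv_def)
  ultimately show "(tangent \<gamma> has_vector_derivative (?v * curvature \<gamma> t) *\<^sub>R (\<i> * tangent \<gamma> t)) (at t)"
    using T by simp
qed

text \<open>\<open>\<delta>\<close> is the determinant of \<open>f\<close>: the unit vector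
  \<open>f \<i>\<close> is orthogonal to \<open>f 1\<close>, so it is plus or minus
  \<open>\<i> * f 1\<close>, and linearity extends this to all \<open>z\<close>.\<close>

lemma orthogonal_transformation_complex:
  assumes "orthogonal_transformation (f :: complex \<Rightarrow> complex)"
  obtains \<delta> :: real where "\<delta> = 1 \<or> \<delta> = -1" "\<And>z. f (\<i> * z) = \<delta> *\<^sub>R (\<i> * f z)"
proof -
  have l: "linear f" and i: "\<And>v w. f v \<bullet> f w = v \<bullet> w"
    using assms by (auto simp: orthogonal_transformation_def)
  have f: "f z = Re z *\<^sub>R f 1 + Im z *\<^sub>R f \<i>" for z
  proof -
    have "z = Re z *\<^sub>R 1 + Im z *\<^sub>R \<i>" by (simp add: complex_eq_iff)
    then have "f z = f (Re z *\<^sub>R 1 + Im z *\<^sub>R \<i>)" by simp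
    then show ?thesis using l by (simp add: linear_add linear_scale)
  qed
  define \<delta> where "\<delta> = f \<i> \<bullet> (\<i> * f 1)"
  have n1: "norm (f 1) = 1" using i[of 1 1] by (simp add: norm_eq_sqrt_inner)
  have fi: "f \<i> = \<delta> *\<^sub>R (\<i> * f 1)"
    unfolding \<delta>_def using i[of \<i> 1] by (intro complex_orthogonal_decomposition n1) simp
  have "norm (f \<i>) = 1" using i[of \<i> \<i>] by (simp add: norm_eq_sqrt_inner)
  then have "\<bar>\<delta>\<bar> = 1" unfolding fi using n1 by (simp add: norm_mult)
  then have \<delta>: "\<delta> = 1 \<or> \<delta> = -1" by linarith
  then have "f (\<i> * z) = \<delta> *\<^sub>R (\<i> * f z)" for z
    by (subst (1 2) f) (auto simp: fi complex_eq_iff algebra_simps)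
  with \<delta> show ?thesis by (rule that)
qed

text \<open>Chain rule. Reversing orientation flips the tangent by \<open>\<sigma>\<close>; the
  curvature changes sign under both a reversal and a reflection (\<open>\<delta> = -1\<close>), and
  scales inversely to length.\<close>

lemma frenet_transform:
  assumes F: "frenet \<gamma> v T k"
    and \<rho>: "\<And>t. (\<rho> has_vector_derivative \<rho>' t) (at t)" "\<And>t. \<rho>' t \<noteq> 0" "\<And>t. \<rho>' t = \<sigma> * \<bar>\<rho>' t\<bar>"
      "\<sigma> = 1 \<or> \<sigma> = -1"
    and f: "orthogonal_transformation f" "\<And>z. f (\<i> * z) = \<delta> *\<^sub>R (\<i> * f z)" and r: "r > 0"
  shows "frenet (\<lambda>t. r *\<^sub>R f (\<gamma> (\<rho> t)) + b) (\<lambda>t. r * v (\<rho> t) * \<bar>\<rho>' t\<bar>)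
    (\<lambda>t. \<sigma> *\<^sub>R f (T (\<rho> t))) (\<lambda>t. \<delta> * \<sigma> * k (\<rho> t) / r)"
  unfolding frenet_def
proof (intro allI conjI)
  fix t
  have l: "bounded_linear f"
    using f(1) by (simp add: orthogonal_transformation_linear linear_conv_bounded_linear[symmetric])
  note F' = F[unfolded frenet_def, rule_format, of "\<rho> t"]
  show "r * v (\<rho> t) * \<bar>\<rho>' t\<bar> > 0" using F' r \<rho>(2) by simp
  show "norm (\<sigma> *\<^sub>R f (T (\<rho> t))) = 1"
    using F' \<rho>(4) f(1) by (auto simp: orthogonal_transformation_norm)
  have s: "\<sigma> * \<sigma> = 1" using \<rho>(4) by auto
  have fr: "f (a *\<^sub>R z) = a *\<^sub>R f z" for a z
    using orthogonal_transformation_linear[OF f(1)] by (rule linear_scale)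
  have chain: "((\<lambda>t. f (g (\<rho> t))) has_vector_derivative (\<sigma> * \<bar>\<rho>' t\<bar>) *\<^sub>R f g') (at t)"
    if "(g has_vector_derivative g') (at (\<rho> t))" for g g'
    using bounded_linear.has_vector_derivative[OF l vector_diff_chain_at[OF \<rho>(1) that]] \<rho>(3)[of t]
    by (simp add: o_def fr)
  have "((\<lambda>t. f (\<gamma> (\<rho> t))) has_vector_derivative
      (\<sigma> * \<bar>\<rho>' t\<bar>) *\<^sub>R f (v (\<rho> t) *\<^sub>R T (\<rho> t))) (at t)"
    using F' by (intro chain) blast
  then show "((\<lambda>t. r *\<^sub>R f (\<gamma> (\<rho> t)) + b) has_vector_derivative
      (r * v (\<rho> t) * \<bar>\<rho>' t\<bar>) *\<^sub>R \<sigma> *\<^sub>R f (T (\<rho> t))) (at t)"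
    by (auto intro!: derivative_eq_intros simp: fr algebra_simps)
  have "((\<lambda>t. f (T (\<rho> t))) has_vector_derivative
      (\<sigma> * \<bar>\<rho>' t\<bar>) *\<^sub>R f ((v (\<rho> t) * k (\<rho> t)) *\<^sub>R (\<i> * T (\<rho> t)))) (at t)"
    using F' by (intro chain) blast
  then have "((\<lambda>t. \<sigma> *\<^sub>R f (T (\<rho> t))) has_vector_derivative
     \<sigma> *\<^sub>R (\<sigma> * \<bar>\<rho>' t\<bar>) *\<^sub>R f ((v (\<rho> t) * k (\<rho> t)) *\<^sub>R (\<i> * T (\<rho> t)))) (at t)"
    by (auto intro!: derivative_eq_intros)
  then show "((\<lambda>t. \<sigma> *\<^sub>R f (T (\<rho> t))) has_vector_derivative
      (r * v (\<rho> t) * \<bar>\<rho>' t\<bar> * (\<delta> * \<sigma> * k (\<rho> t) / r)) *\<^sub>R (\<i> * (\<sigma> *\<^sub>R f (T (\<rho> t))))) (at t)"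
    using r by (simp add: fr f(2) algebra_simps)
qed

text \<open>The stationary equation without closedness, so that it also applies to curves
  parametrised over the whole line.\<close>

definition critical :: "real \<Rightarrow> (real \<Rightarrow> complex) \<Rightarrow> bool" where
  "critical c \<gamma> \<longleftrightarrow> immersed \<gamma> \<and>
     (\<forall>t. arc_deriv \<gamma> (arc_deriv \<gamma> (curvature \<gamma>)) t + c * curvature \<gamma> t ^ 3 = 0)"

lemma stationary_iff_critical:
  "stationary c \<gamma> \<longleftrightarrow> critical c \<gamma> \<and> (\<forall>t. \<gamma> (t + 2 * pi) = \<gamma> t)"
  by (auto simp: stationary_def critical_def closed_immersed_def)

text \<open>Each arclength derivative contributes a factor \<open>\<sigma> / r\<close> and the
  curvature a factor \<open>\<delta> * \<sigma> / r\<close>. Since odd powers of a sign equal the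
  sign, both terms of the equation acquire the same factor
  \<open>\<delta> * \<sigma> / r ^ 3\<close>.\<close>

lemma critical_transform:
  assumes \<gamma>: "critical c \<gamma>" and \<rho>: "smooth \<rho>" "\<And>t. vector_derivative \<rho> (at t) \<noteq> 0"
    and S: "similarity S"
  shows "critical c (\<lambda>t. S (\<gamma> (\<rho> t)))"
proof -
  have imm: "immersed \<gamma>" using \<gamma> by (simp add: critical_def)
  let ?\<rho>' = "\<lambda>t. vector_derivative \<rho> (at t)" and ?v = "\<lambda>t. norm (vector_derivative \<gamma> (at t))"
  let ?\<eta> = "\<lambda>t. S (\<gamma> (\<rho> t))"
  obtain \<sigma> :: real where \<sigma>: "\<sigma> = 1 \<or> \<sigma> = -1" "\<And>t. ?\<rho>' t = \<sigma> * \<bar>?\<rho>' t\<bar>"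
    using nonvanishing_derivative_sign[OF \<rho>] by blast
  obtain r f b where S: "r > 0" "orthogonal_transformation f" "S = (\<lambda>z. r *\<^sub>R f z + b)"
    using S by (auto simp: similarity_def)
  obtain \<delta> :: real where \<delta>: "\<delta> = 1 \<or> \<delta> = -1" "\<And>z. f (\<i> * z) = \<delta> *\<^sub>R (\<i> * f z)"
    using orthogonal_transformation_complex[OF S(2)] by blast
  have l: "bounded_linear f"
    using S(2) by (simp add: orthogonal_transformation_linear linear_conv_bounded_linear[symmetric])
  note d\<rho> = smooth_has_vector_derivative[OF \<rho>(1)]
  have F: "frenet ?\<eta> (\<lambda>t. r * ?v (\<rho> t) * \<bar>?\<rho>' t\<bar>)
    (\<lambda>t. \<sigma> *\<^sub>R f (tangent \<gamma> (\<rho> t))) (\<lambda>t. \<delta> * \<sigma> * curvature \<gamma> (\<rho> t) / r)"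
    unfolding S(3)
    by (rule frenet_transform[OF immersed_frenet[OF imm] d\<rho> \<rho>(2) \<sigma>(2,1) S(2) \<delta>(2) S(1)])
  have v: "?v t > 0" for t using imm by (simp add: immersed_def)
  have "vector_derivative ?\<eta> (at t) \<noteq> 0" for t
    using F[unfolded frenet_def, rule_format, of t] vector_derivative_at[of ?\<eta> _ t] by fastforce
  moreover have "smooth ?\<eta>"
    unfolding S(3) using imm
    by (intro smooth_intros smooth_linear[OF l smooth_compose[OF _ \<rho>(1)]]) (simp add: immersed_def)
  ultimately have imm': "immersed ?\<eta>" by (simp add: immersed_def)
  \<comment> \<open>The constant \<open>C\<close> is carried along so that the rule can be applied
    again to its own result.\<close>
  have arc: "arc_deriv ?\<eta> (\<lambda>t. C * g (\<rho> t)) = (\<lambda>t. (C * \<sigma> / r) * arc_deriv \<gamma> g (\<rho> t))"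
    if g: "smooth g" for C :: real and g :: "real \<Rightarrow> real"
  proof
    fix t
    have "((\<lambda>t. g (\<rho> t)) has_vector_derivative ?\<rho>' t * vector_derivative g (at (\<rho> t))) (at t)"
      using vector_diff_chain_at[OF d\<rho> smooth_has_vector_derivative[OF g]] by (simp add: o_def)
    then have "((\<lambda>t. C * g (\<rho> t)) has_vector_derivative C * (?\<rho>' t * vector_derivative g (at (\<rho> t)))) (at t)"
      by (auto intro!: derivative_eq_intros)
    moreover have "C * (?\<rho>' t * vector_derivative g (at (\<rho> t))) =
       (r * ?v (\<rho> t) * \<bar>?\<rho>' t\<bar>) *\<^sub>R ((C * \<sigma> / r) * arc_deriv \<gamma> g (\<rho> t))"
      using v[of "\<rho> t"] S(1) by (subst \<sigma>(2)) (simp add: arc_deriv_def field_simps)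
    ultimately show "arc_deriv ?\<eta> (\<lambda>t. C * g (\<rho> t)) t = (C * \<sigma> / r) * arc_deriv \<gamma> g (\<rho> t)"
      by (intro frenet_arc_deriv[OF F]) simp
  qed
  note k = immersed_smooth(2)[OF imm]
  have K: "curvature ?\<eta> = (\<lambda>t. \<delta> * \<sigma> / r * curvature \<gamma> (\<rho> t))"
    using frenet_curvature[OF F] by simp
  have "arc_deriv ?\<eta> (arc_deriv ?\<eta> (curvature ?\<eta>)) t + c * curvature ?\<eta> t ^ 3 = 0" for t
  proof -
    have "arc_deriv ?\<eta> (arc_deriv ?\<eta> (curvature ?\<eta>)) t + c * curvature ?\<eta> t ^ 3 =
      \<delta> * \<sigma> / r ^ 3 * (arc_deriv \<gamma> (arc_deriv \<gamma> (curvature \<gamma>)) (\<rho> t) + c * curvature \<gamma> (\<rho> t) ^ 3)"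
      unfolding K arc[OF k] arc[OF smooth_arc_deriv[OF imm k]] using \<delta>(1) \<sigma>(1)
      by (elim disjE) (simp_all add: power3_eq_cube add_divide_distrib)
    then show ?thesis using \<gamma> by (simp add: critical_def)
  qed
  with imm' show ?thesis by (simp add: critical_def)
qed

lemma interval_integral_has_vector_derivative:
  fixes f :: "real \<Rightarrow> 'a::euclidean_space"
  assumes c: "\<And>t. isCont f t"
  shows "((\<lambda>x. LBINT y=ereal a..ereal x. f y) has_vector_derivative f x) (at x)"
proof -
  obtain F where F: "\<And>t. (F has_vector_derivative f t) (at t)"
    using antiderivative_exists[OF c] by blast
  have "(LBINT y=ereal a..ereal x. f y) = F x - F a" for x
    using c F by (intro interval_integral_FTC_finite)
      (auto intro: continuous_at_imp_continuous_on has_vector_derivative_at_within)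
  then show ?thesis using F[of x] by (auto intro!: derivative_eq_intros)
qed

subsection \<open>The elliptic functions of modulus one half\<close>

lemma ell_F_0 [simp]: "ell_F 0 m = 0"
  by (simp add: ell_F_def)

lemma one_minus_sin_sq_pos: "m < 1 \<Longrightarrow> 0 < 1 - m * (sin \<theta>)\<^sup>2" for m :: real
proof -
  assume m: "m < 1"
  have s: "(sin \<theta>)\<^sup>2 \<le> 1" using abs_sin_le_one[of \<theta>] by (simp add: abs_square_le_1)
  show ?thesis
  proof (cases "sin \<theta> = 0")
    case False
    then have "0 < (1 - m) * (sin \<theta>)\<^sup>2" using m by simp
    also have "\<dots> \<le> 1 - m * (sin \<theta>)\<^sup>2" using s by (simp add: algebra_simps)
    finally show ?thesis .
  qed simp
qed

context
  fixes m :: real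
  assumes m: "m < 1"
begin

lemma ell_F_has_real_derivative:
  "((\<lambda>x. ell_F x m) has_real_derivative 1 / sqrt (1 - m * (sin x)\<^sup>2)) (at x)"
  unfolding ell_F_def has_vector_derivative_real[symmetric]
  using one_minus_sin_sq_pos[OF m, THEN less_imp_neq]
  by (intro interval_integral_has_vector_derivative) (auto intro!: continuous_intros)

lemma ell_F_shift: "ell_F (x + 2 * pi) m = ell_F x m + ell_F (2 * pi) m"
proof -
  have "((\<lambda>x. ell_F (x + 2 * pi) m) has_vector_derivative 1 / sqrt (1 - m * (sin x)\<^sup>2)) (at x)" for x
    unfolding has_vector_derivative_real
    using DERIV_shift[of "\<lambda>x. ell_F x m" _ x "2 * pi"] ell_F_has_real_derivative[of "x + 2 * pi"] by simp
  from same_derivative_shift[OF this ell_F_has_real_derivative[folded has_vector_derivative_real], of x 0]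
  show ?thesis by simp
qed

lemma bij_ell_F: "bij (\<lambda>x. ell_F x m)" and ell_F_2pi_pos: "ell_F (2 * pi) m > 0"
proof -
  have p: "0 < 1 / sqrt (1 - m * (sin x)\<^sup>2)" for x
    using one_minus_sin_sq_pos[OF m, of x] by simp
  have q: "0 < 2 * pi" by simp
  show "bij (\<lambda>x. ell_F x m)" "ell_F (2 * pi) m > 0"
    using bij_quasiperiodic[OF ell_F_has_real_derivative p q ell_F_shift] by blast+
qed

lemma am_ell_F [simp]: "am (ell_F x m) m = x"
  unfolding am_def using inv_f_f[OF bij_is_inj[OF bij_ell_F]] .

lemma ell_F_am [simp]: "ell_F (am x m) m = x"
  unfolding am_def using surj_f_inv_f[OF bij_is_surj[OF bij_ell_F]] .

lemma am_has_real_derivative: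
  "((\<lambda>x. am x m) has_real_derivative sqrt (1 - m * (sin (am x m))\<^sup>2)) (at x)"
proof -
  have "1 / sqrt (1 - m * (sin x)\<^sup>2) \<noteq> 0" for x using one_minus_sin_sq_pos[OF m, of x] by simp
  from inv_has_real_derivative[OF ell_F_has_real_derivative this bij_ell_F, of x]
  show ?thesis by (simp add: am_def)
qed

lemma am_shift: "am (x + ell_F (2 * pi) m) m = am x m + 2 * pi"
  using am_ell_F[of "am x m + 2 * pi"] by (simp add: ell_F_shift)

end

lemma smooth_sin: "smooth sin" and smooth_cos: "smooth cos"
  using smooth_linear[OF bounded_linear_Im smooth_cis] smooth_linear[OF bounded_linear_Re smooth_cis]
  by simp_all

text \<open>This is \<open>4 * K\<close>, with \<open>K = ell_F (pi / 2) (1 / 2)\<close> the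
  complete elliptic integral. Below it, \<open>sn\<close> and \<open>dn\<close> are the Jacobi
  functions with parameter \<open>m = 1 / 2\<close>.\<close>

definition cn_period :: real where "cn_period = ell_F (2 * pi) (1 / 2)"
definition sn :: "real \<Rightarrow> real" where "sn s = sin (am s (1 / 2))"
definition dn :: "real \<Rightarrow> real" where "dn s = sqrt (1 - (sn s)\<^sup>2 / 2)"

lemma cn_period_pos: "cn_period > 0"
  unfolding cn_period_def by (rule ell_F_2pi_pos) simp

lemma am_half_deriv [derivative_intros]: "((\<lambda>s. am s (1 / 2)) has_real_derivative dn s) (at s)"
  using am_has_real_derivative[of "1/2" s] by (simp add: dn_def sn_def)

lemma am_half_shift: "am (s + cn_period) (1 / 2) = am s (1 / 2) + 2 * pi"
  unfolding cn_period_def by (rule am_shift) simp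

lemma am_half_0: "am 0 (1 / 2) = 0"
  using am_ell_F[of "1/2" 0] by simp

lemma cn_sn_0: "cn 0 (1 / 2) = 1" "sn 0 = 0"
  by (simp_all add: cn_def sn_def am_half_0)

lemma cn_sn_shift: "cn (s + cn_period) (1 / 2) = cn s (1 / 2)" "sn (s + cn_period) = sn s"
  by (simp_all add: cn_def sn_def am_half_shift)

text \<open>Evaluating at \<open>0\<close> gives \<open>cn p = 1\<close>, so the amplitude of
  \<open>p\<close> is a multiple of \<open>2 * pi\<close>; applying \<open>ell_F\<close> recovers
  \<open>p\<close>.\<close>

lemma cn_shift_imp_multiple:
  assumes "\<And>s. cn (s + p) (1 / 2) = cn s (1 / 2)"
  obtains n :: int where "p = of_int n * cn_period"
proof -
  have "cos (am p (1 / 2)) = 1" using assms[of 0] by (simp add: cn_def am_half_0)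
  then obtain n :: int where n: "am p (1 / 2) = of_int n * 2 * pi" unfolding cos_one_2pi_int by blast
  have "am (0 + of_int n * cn_period) (1 / 2) = am 0 (1 / 2) + of_int n *\<^sub>R (2 * pi)"
    by (rule shift_of_int) (rule am_half_shift)
  then have "am (of_int n * cn_period) (1 / 2) = am p (1 / 2)" using n by (simp add: am_half_0)
  then have "of_int n * cn_period = p"
    using ell_F_am[of "1/2" p] ell_F_am[of "1/2" "of_int n * cn_period"] by simp
  then show ?thesis using that by blast
qed

lemma sn_cn_sq: "(sn s)\<^sup>2 = 1 - (cn s (1 / 2))\<^sup>2"
  by (simp add: sn_def cn_def sin_squared_eq)

lemma sn_sq_le: "(sn s)\<^sup>2 \<le> 1"
  by (simp add: sn_cn_sq)

lemma dn_pos: "dn s > 0"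
  using sn_sq_le[of s] by (simp add: dn_def)

lemma dn_sq: "(dn s)\<^sup>2 = 1 - (sn s)\<^sup>2 / 2"
  using sn_sq_le[of s] by (simp add: dn_def)

lemma cn_deriv: "((\<lambda>s. cn s (1 / 2)) has_real_derivative - (sn s * dn s)) (at s)"
  unfolding cn_def sn_def by (auto intro!: derivative_eq_intros)

lemma sn_deriv: "(sn has_real_derivative cn s (1 / 2) * dn s) (at s)"
  unfolding cn_def sn_def[abs_def] by (auto intro!: derivative_eq_intros)

lemma dn_deriv: "(dn has_real_derivative - (sn s * cn s (1 / 2)) / 2) (at s)"
proof -
  have "0 < 1 - (sn s)\<^sup>2 / 2" using sn_sq_le[of s] by simp
  moreover have "((\<lambda>s. 1 - (sn s)\<^sup>2 / 2) has_real_derivative - (sn s * (cn s (1 / 2) * dn s))) (at s)"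
    by (auto intro!: derivative_eq_intros sn_deriv)
  ultimately have "(dn has_real_derivative inverse (dn s) / 2 * - (sn s * (cn s (1 / 2) * dn s))) (at s)"
    unfolding dn_def[abs_def] by (intro DERIV_chain2[OF DERIV_real_sqrt]) (simp_all add: dn_def)
  moreover have "inverse (dn s) / 2 * - (sn s * (cn s (1 / 2) * dn s)) = - (sn s * cn s (1 / 2)) / 2"
    using dn_pos[of s] by (simp add: field_simps)
  ultimately show ?thesis by (simp only:)
qed

text \<open>Since \<open>- sn * dn\<close> is the derivative of \<open>cn\<close>, this says
  \<open>cn'' = - cn ^ 3\<close>. In general
  \<open>cn'' = (2 * m - 1) * cn - 2 * m * cn ^ 3\<close>, and \<open>m = 1 / 2\<close> is the value
  that removes the linear term.\<close>

lemma sn_dn_deriv: "((\<lambda>s. - (sn s * dn s)) has_real_derivative - (cn s (1 / 2) ^ 3)) (at s)"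
proof -
  have "((\<lambda>s. - (sn s * dn s)) has_real_derivative
      - (cn s (1 / 2) * dn s * dn s + (- (sn s * cn s (1 / 2)) / 2) * sn s)) (at s)"
    by (rule DERIV_minus[OF DERIV_mult[OF sn_deriv dn_deriv]])
  also have "cn s (1 / 2) * dn s * dn s + (- (sn s * cn s (1 / 2)) / 2) * sn s =
      cn s (1 / 2) * ((dn s)\<^sup>2 - (sn s)\<^sup>2 / 2)"
    by (simp add: power2_eq_square algebra_simps)
  also have "(dn s)\<^sup>2 - (sn s)\<^sup>2 / 2 = (cn s (1 / 2))\<^sup>2" by (simp add: dn_sq sn_cn_sq)
  also have "cn s (1 / 2) * (cn s (1 / 2))\<^sup>2 = cn s (1 / 2) ^ 3"
    by (simp add: power2_eq_square power3_eq_cube)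
  finally show ?thesis .
qed

lemma cn_energy: "(sn s * dn s)\<^sup>2 = (1 - cn s (1 / 2) ^ 4) / 2"
proof -
  have "(sn s * dn s)\<^sup>2 = (1 - (cn s (1 / 2))\<^sup>2) * (1 + (cn s (1 / 2))\<^sup>2) / 2"
    by (simp add: power_mult_distrib dn_sq sn_cn_sq field_simps)
  then show ?thesis by (simp add: algebra_simps flip: power2_eq_square)
qed

text \<open>The orbit of \<open>cn\<close> fills its whole energy level, so any initial data of
  energy \<open>1\<close> are attained at some phase.\<close>

lemma cn_phase_exists:
  assumes "2 * y\<^sup>2 + x ^ 4 = (1::real)"
  obtains s where "cn s (1 / 2) = x" "sn s * dn s = y"
proof -
  have "x ^ 4 \<le> 1" using assms by (smt (verit) zero_le_power2)
  then have "\<bar>x\<bar> \<le> 1" by (metis abs_ge_zero power_even_abs_numeral even_numeral not_le one_less_power zero_less_numeral)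
  \<comment> \<open>The amplitude has cosine \<open>x\<close>; its sign is chosen so that
    \<open>sn\<close>, and with it \<open>sn * dn\<close>, has the sign of \<open>y\<close>, because
    \<open>dn > 0\<close>.\<close>
  define \<theta> where "\<theta> = (if y \<ge> 0 then arccos x else - arccos x)"
  define s where "s = ell_F \<theta> (1 / 2)"
  have c: "cn s (1 / 2) = x" "sn s = sin \<theta>"
    using \<open>\<bar>x\<bar> \<le> 1\<close> by (auto simp: cn_def sn_def s_def \<theta>_def)
  have "sin (arccos x) \<ge> 0" using \<open>\<bar>x\<bar> \<le> 1\<close> by (simp add: sin_arccos_abs abs_square_le_1)
  then have sg: "y \<ge> 0 \<Longrightarrow> sn s * dn s \<ge> 0" "y < 0 \<Longrightarrow> sn s * dn s \<le> 0"
    using dn_pos[of s] by (auto simp: c \<theta>_def mult_nonpos_nonneg)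
  have "(sn s * dn s)\<^sup>2 = y\<^sup>2" using assms cn_energy[of s] by (simp add: c)
  then consider "sn s * dn s = y" | "sn s * dn s = - y" unfolding power2_eq_iff by blast
  then have "sn s * dn s = y" using sg by cases linarith+
  with c show ?thesis using that by blast
qed

lemma smooth_am: "smooth (\<lambda>s. am s (1 / 2))"
proof (rule smooth_autonomous_ode[where h = "\<lambda>x. sqrt (1 - 1/2 * (sin x * sin x))"])
  show "((\<lambda>s. am s (1 / 2)) has_vector_derivative sqrt (1 - 1/2 * (sin (am t (1/2)) * sin (am t (1/2))))) (at t)" for t
    using am_has_real_derivative[of "1/2" t] by (simp add: has_vector_derivative_real power2_eq_square)
  show "smooth (\<lambda>x. sqrt (1 - 1/2 * (sin x * sin x)))"
    using one_minus_sin_sq_pos[of "1/2"] by (intro smooth_intros smooth_sin) (simp_all add: power2_eq_square)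
qed

lemma smooth_cn: "smooth (\<lambda>s. cn s (1 / 2))"
  unfolding cn_def by (rule smooth_compose[OF smooth_cos smooth_am])

subsection \<open>Which free curves close up\<close>

text \<open>The angle \<open>\<phi>\<close> of the opening text. The argument of
  \<open>arcsin\<close> stays at most \<open>1 / sqrt 2\<close> in absolute value, away from the
  endpoints where \<open>arcsin\<close> is not differentiable.\<close>

definition tilt :: "real \<Rightarrow> real" where "tilt s = 2 * arcsin (sn s / sqrt 2)"

lemma sn_div_sqrt2: "\<bar>sn s / sqrt 2\<bar> < 1" "(sn s / sqrt 2)\<^sup>2 = (sn s)\<^sup>2 / 2"
proof -
  show *: "(sn s / sqrt 2)\<^sup>2 = (sn s)\<^sup>2 / 2" by (simp add: power_divide)
  then have "(sn s / sqrt 2)\<^sup>2 < 1" using sn_sq_le[of s] by simp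
  then show "\<bar>sn s / sqrt 2\<bar> < 1" by (simp add: abs_square_less_1)
qed

lemma tilt_deriv: "(tilt has_real_derivative sqrt 2 * cn s (1 / 2)) (at s)"
proof -
  have "-1 < sn s / sqrt 2" "sn s / sqrt 2 < 1" using sn_div_sqrt2(1)[of s] by linarith+
  note * = DERIV_chain2[OF DERIV_arcsin[OF this] DERIV_cdivide[OF sn_deriv]]
  have "(tilt has_real_derivative 2 * (inverse (dn s) * (cn s (1 / 2) * dn s / sqrt 2))) (at s)"
    unfolding tilt_def[abs_def] using DERIV_cmult[OF *, of 2]
    unfolding sn_div_sqrt2(2) dn_def[symmetric] .
  moreover have "2 * (inverse (dn s) * (cn s (1 / 2) * dn s / sqrt 2)) = sqrt 2 * cn s (1 / 2)"
    using dn_pos[of s] by (simp add: field_simps)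
  ultimately show ?thesis by simp
qed

lemma sin_arcsin_sn: "sin (arcsin (sn s / sqrt 2)) = sn s / sqrt 2"
  using sn_div_sqrt2(1)[of s] by (intro sin_arcsin) linarith+

lemma cos_tilt: "cos (tilt s) = (cn s (1 / 2))\<^sup>2"
  unfolding tilt_def cos_double_sin sin_arcsin_sn sn_div_sqrt2(2) by (simp add: sn_cn_sq field_simps)

lemma sin_tilt: "sin (tilt s) = sqrt 2 * (sn s * dn s)"
proof -
  have "sin (tilt s) = 2 * (sn s / sqrt 2) * dn s"
  proof -
    have "cos (arcsin (sn s / sqrt 2)) = sqrt (1 - (sn s / sqrt 2)\<^sup>2)"
      using sn_div_sqrt2(1)[of s] by (intro cos_arcsin) linarith+
    then have "cos (arcsin (sn s / sqrt 2)) = dn s" unfolding sn_div_sqrt2(2) dn_def .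
    then show ?thesis unfolding tilt_def sin_double sin_arcsin_sn by simp
  qed
  also have "\<dots> = 2 / sqrt 2 * (sn s * dn s)" by simp
  also have "2 / sqrt 2 = sqrt 2" by (simp add: real_div_sqrt)
  finally show ?thesis .
qed

text \<open>The range of \<open>arcsin\<close> gives only the bound \<open>pi\<close>; beyond
  \<open>pi / 2\<close> the cosine would be negative, whereas it equals the square of
  \<open>cn\<close>.\<close>

lemma tilt_bound: "\<bar>tilt s\<bar> \<le> pi / 2"
proof (rule ccontr)
  assume "\<not> ?thesis"
  moreover have "\<bar>tilt s\<bar> \<le> pi"
  proof -
    have "-1 \<le> sn s / sqrt 2" "sn s / sqrt 2 \<le> 1" using sn_div_sqrt2(1)[of s] by linarith+
    from arcsin_bounded[OF this] show ?thesis unfolding tilt_def by linarith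
  qed
  ultimately have "cos \<bar>tilt s\<bar> < 0" using pi_gt_zero by (intro cos_lt_zero_pi) linarith+
  then show False by (simp add: cos_tilt not_less[symmetric])
qed

lemma tilt_0: "tilt 0 = 0"
  by (simp add: tilt_def cn_sn_0)

lemma tilt_shift: "tilt (s + cn_period) = tilt s"
  by (simp add: tilt_def cn_sn_shift)

lemma smooth_tilt: "smooth tilt"
proof (rule smoothI)
  show "(tilt has_vector_derivative sqrt 2 * cn t (1 / 2)) (at t)" for t
    using tilt_deriv by (simp add: has_vector_derivative_real)
qed (intro smooth_intros smooth_cn)

lemma has_vector_derivative_cis:
  assumes "(g has_real_derivative g') (at t)"
  shows "((\<lambda>t. cis (g t)) has_vector_derivative g' *\<^sub>R (\<i> * cis (g t))) (at t)"
  using has_derivative_cis[OF assms[unfolded has_field_derivative_def]]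
  by (simp add: has_vector_derivative_def mult.commute)

lemma cis_tilt_deriv:
  "((\<lambda>s. cis (a * tilt s)) has_vector_derivative (a * sqrt 2 * cn s (1 / 2)) *\<^sub>R (\<i> * cis (a * tilt s))) (at s)"
  using has_vector_derivative_cis[OF DERIV_cmult[OF tilt_deriv]] by (simp add: mult.assoc)

text \<open>Arclength parametrised with curvature \<open>cn / sqrt c\<close>, where \<open>a = 1 / sqrt (2 * c)\<close>.\<close>

definition elastica :: "real \<Rightarrow> real \<Rightarrow> complex" where
  "elastica a s = (LBINT u=ereal 0..ereal s. cis (a * tilt u))"

lemma elastica_deriv: "(elastica a has_vector_derivative cis (a * tilt s)) (at s)"
proof -
  have "isCont (\<lambda>u. cis (a * tilt u)) t" for t
    by (rule has_vector_derivative_continuous[OF cis_tilt_deriv])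
  then show ?thesis unfolding elastica_def[abs_def] by (rule interval_integral_has_vector_derivative)
qed

lemma elastica_0: "elastica a 0 = 0"
  by (simp add: elastica_def)

lemma elastica_frenet:
  "frenet (elastica a) (\<lambda>s. 1) (\<lambda>s. cis (a * tilt s)) (\<lambda>s. a * sqrt 2 * cn s (1 / 2))"
  using elastica_deriv cis_tilt_deriv by (simp add: frenet_def)

text \<open>The tangent is periodic, so each period of \<open>cn\<close> adds one fixed
  displacement. Hence closing up amounts to the vanishing of
  \<open>elastica a cn_period\<close>.\<close>

lemma elastica_shift: "elastica a (s + cn_period) = elastica a s + elastica a cn_period"
proof -
  have "((\<lambda>s. elastica a (s + cn_period)) has_vector_derivative cis (a * tilt s)) (at s)" for s
  proof -
    have "((\<lambda>s. s + cn_period) has_vector_derivative 1) (at s)"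
      by (auto intro!: derivative_eq_intros)
    from vector_diff_chain_at[OF this elastica_deriv] show ?thesis by (simp add: o_def tilt_shift)
  qed
  from same_derivative_shift[OF this elastica_deriv, of s 0] show ?thesis
    by (simp add: elastica_0 algebra_simps)
qed

lemma elastica_recursion:
  "(2 * b + 1) *\<^sub>R elastica (b + 1) cn_period + (2 * b - 1) *\<^sub>R elastica (b - 1) cn_period = 0"
proof -
  \<comment> \<open>\<open>?g\<close> is chosen to have the same derivative as \<open>?h\<close>.
    Being periodic, it forces \<open>?h\<close> at \<open>cn_period\<close> to equal
    \<open>?h 0 = 0\<close>.\<close>
  let ?g = "\<lambda>s. (- 2 * sqrt 2 * cn s (1 / 2)) *\<^sub>R (\<i> * cis (b * tilt s))"
  let ?h = "\<lambda>s. (2 * b + 1) *\<^sub>R elastica (b + 1) s + (2 * b - 1) *\<^sub>R elastica (b - 1) s"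
  have "(?h has_vector_derivative
      (2 * b + 1) *\<^sub>R cis ((b + 1) * tilt s) + (2 * b - 1) *\<^sub>R cis ((b - 1) * tilt s)) (at s)" for s
    by (auto intro!: derivative_eq_intros elastica_deriv)
  moreover have "(?g has_vector_derivative
      (2 * b + 1) *\<^sub>R cis ((b + 1) * tilt s) + (2 * b - 1) *\<^sub>R cis ((b - 1) * tilt s)) (at s)" for s
  proof -
    let ?C = "cn s (1 / 2)" and ?S = "sn s * dn s" and ?e = "cis (b * tilt s)"
    have "(?g has_vector_derivative
      (- 2 * sqrt 2 * ?C) *\<^sub>R (\<i> * ((b * sqrt 2 * ?C) *\<^sub>R (\<i> * ?e))) +
      (2 * sqrt 2 * ?S) *\<^sub>R (\<i> * ?e)) (at s)"
      by (auto intro!: derivative_eq_intros cn_deriv cis_tilt_deriv)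
    \<comment> \<open>Multiplication by \<open>cis (tilt s)\<close> or by its conjugate shifts the
      frequency; \<open>cos_tilt\<close> and \<open>sin_tilt\<close> express that factor through
      \<open>cn\<close> and \<open>sn * dn\<close>.\<close>
    moreover have "cis ((b + 1) * tilt s) = ?e * (of_real (?C\<^sup>2) + \<i> * of_real (sqrt 2 * ?S))"
      "cis ((b - 1) * tilt s) = ?e * (of_real (?C\<^sup>2) - \<i> * of_real (sqrt 2 * ?S))"
      by (simp_all add: complex_eq_iff algebra_simps cos_add sin_add cos_diff sin_diff cos_tilt sin_tilt)
    moreover have "sqrt 2 * (sqrt 2 * x) = 2 * x" for x :: real
      by (simp flip: mult.assoc)
    then have "(- 2 * sqrt 2 * ?C) *\<^sub>R (\<i> * ((b * sqrt 2 * ?C) *\<^sub>R (\<i> * ?e))) + (2 * sqrt 2 * ?S) *\<^sub>R (\<i> * ?e) =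
        (2 * b + 1) *\<^sub>R (?e * (of_real (?C\<^sup>2) + \<i> * of_real (sqrt 2 * ?S))) +
        (2 * b - 1) *\<^sub>R (?e * (of_real (?C\<^sup>2) - \<i> * of_real (sqrt 2 * ?S)))"
      by (simp add: complex_eq_iff power2_eq_square algebra_simps del: cis.simps)
    ultimately show ?thesis by simp
  qed
  ultimately have "?h cn_period - ?g cn_period = ?h 0 - ?g 0"
    by (rule same_derivative_shift)
  then show ?thesis
    using cn_sn_shift(1)[of 0] tilt_shift[of 0] by (simp add: elastica_0)
qed

text \<open>For such \<open>a\<close> the angle \<open>a * tilt s\<close> stays within
  \<open>pi / 2\<close>, so the real part never decreases. It strictly increases just after
  \<open>0\<close>, where the tilt vanishes and its derivative is \<open>1\<close>.\<close>

lemma elastica_period_nonzero: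
  assumes "\<bar>a\<bar> \<le> 1"
  shows "elastica a cn_period \<noteq> 0"
proof -
  let ?f = "\<lambda>s. Re (elastica a s)"
  have d: "(?f has_real_derivative cos (a * tilt s)) (at s)" for s
    using bounded_linear.has_vector_derivative[OF bounded_linear_Re elastica_deriv]
    by (simp add: has_vector_derivative_real)
  have "cos (a * tilt s) \<ge> 0" for s
  proof -
    have "\<bar>a * tilt s\<bar> \<le> 1 * (pi / 2)"
      unfolding abs_mult using assms tilt_bound by (intro mult_mono) auto
    then show ?thesis by (intro cos_ge_zero) linarith+
  qed
  then have mono: "s \<le> t \<Longrightarrow> ?f s \<le> ?f t" for s t
    using d by (intro DERIV_nonneg_imp_nondecreasing[of s t ?f]) blast+
  have "(?f has_real_derivative 1) (at 0)" using d[of 0] by (simp add: tilt_0)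
  from DERIV_pos_inc_right[OF this]
  obtain e where e: "e > 0" "\<And>h. 0 < h \<Longrightarrow> h < e \<Longrightarrow> ?f 0 < ?f (0 + h)" by auto
  define h where "h = min (e / 2) cn_period"
  have "0 < h" "h < e" "h \<le> cn_period" using e(1) cn_period_pos by (auto simp: h_def)
  then have "0 < ?f cn_period" using e(2)[of h] mono[of h cn_period] by (simp add: elastica_0)
  then show ?thesis by auto
qed

text \<open>The recursion at \<open>b = a - 1\<close> relates \<open>a\<close> to
  \<open>a - 2\<close>. For \<open>a > 2\<close> both coefficients are nonzero, so zeros are
  translated by \<open>2\<close>; below that, the only zero arises from the coefficient
  \<open>2 * a - 3\<close>. The induction is on a bound \<open>2 * n\<close> for
  \<open>a\<close>.\<close>

lemma elastica_closed_iff: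
  assumes "a \<ge> 0"
  shows "elastica a cn_period = 0 \<longleftrightarrow> (\<exists>j::nat\<ge>1. a = (4 * real j - 1) / 2)"
proof -
  have "a \<ge> 0 \<Longrightarrow> a \<le> 2 * real n \<Longrightarrow>
      elastica a cn_period = 0 \<longleftrightarrow> (\<exists>j::nat\<ge>1. a = (4 * real j - 1) / 2)" for n and a :: real
  proof (induction n arbitrary: a)
    case 0
    then show ?case using elastica_period_nonzero[of a] by (auto simp: field_simps)
  next
    case (Suc n)
    \<comment> \<open>On the middle interval \<open>\<bar>a - 2\<bar> \<le> 1\<close>, so the
      integral at \<open>a - 2\<close> is nonzero and the one at \<open>a\<close> vanishes exactly
      at \<open>a = 3 / 2\<close>, the value for \<open>j = 1\<close>.\<close>
    consider "a \<le> 1" | "1 < a" "a \<le> 2" | "a > 2" by linarith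
    then show ?case
    proof cases
      case 1
      then show ?thesis using Suc.prems elastica_period_nonzero[of a] by (auto simp: field_simps)
    next
      case 2
      then have nz: "elastica (a - 2) cn_period \<noteq> 0" by (intro elastica_period_nonzero) linarith
      have "(2 * a - 1) *\<^sub>R elastica a cn_period = - ((2 * a - 3) *\<^sub>R elastica (a - 2) cn_period)"
        using elastica_recursion[of "a - 1"] by (simp add: algebra_simps eq_neg_iff_add_eq_0)
      then have "(2 * a - 1) *\<^sub>R elastica a cn_period = 0 \<longleftrightarrow> (2 * a - 3) *\<^sub>R elastica (a - 2) cn_period = 0"
        by simp
      moreover have "2 * a - 1 \<noteq> 0" "2 * a - 3 = 0 \<longleftrightarrow> a = 3 / 2" using 2 by linarith+
      ultimately have "elastica a cn_period = 0 \<longleftrightarrow> a = 3 / 2"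
        using nz by (simp only: scaleR_eq_0_iff) simp
      also have "\<dots> \<longleftrightarrow> (\<exists>j::nat\<ge>1. a = (4 * real j - 1) / 2)"
      proof
        assume "a = 3 / 2"
        then show "\<exists>j::nat\<ge>1. a = (4 * real j - 1) / 2" by (intro exI[of _ 1]) auto
      next
        assume "\<exists>j::nat\<ge>1. a = (4 * real j - 1) / 2"
        then obtain j :: nat where j: "j \<ge> 1" "a = (4 * real j - 1) / 2" by blast
        then have "j < 2" using 2 by auto
        then have "j = 1" using j(1) by simp
        then show "a = 3 / 2" using j by simp
      qed
      finally show ?thesis .
    next
      case 3
      have "(2 * a - 1) *\<^sub>R elastica a cn_period = - ((2 * a - 3) *\<^sub>R elastica (a - 2) cn_period)"
        using elastica_recursion[of "a - 1"] by (simp add: algebra_simps eq_neg_iff_add_eq_0)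
      then have "elastica a cn_period = 0 \<longleftrightarrow> elastica (a - 2) cn_period = 0"
        using 3 by auto
      also have "\<dots> \<longleftrightarrow> (\<exists>j::nat\<ge>1. a - 2 = (4 * real j - 1) / 2)"
        using 3 Suc.prems by (intro Suc.IH) auto
      also have "\<dots> \<longleftrightarrow> (\<exists>j::nat\<ge>1. a = (4 * real j - 1) / 2)"
      proof
        assume "\<exists>j::nat\<ge>1. a - 2 = (4 * real j - 1) / 2"
        then obtain j :: nat where "j \<ge> 1" "a - 2 = (4 * real j - 1) / 2" by blast
        then show "\<exists>j::nat\<ge>1. a = (4 * real j - 1) / 2" by (intro exI[of _ "Suc j"]) auto
      next
        assume "\<exists>j::nat\<ge>1. a = (4 * real j - 1) / 2"
        then obtain j :: nat where j: "j \<ge> 1" "a = (4 * real j - 1) / 2" by blast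
        then have "j \<ge> 2" using 3 by (cases "j = 1") auto
        then show "\<exists>j::nat\<ge>1. a - 2 = (4 * real j - 1) / 2"
          using j by (intro exI[of _ "j - 1"]) (auto simp: of_nat_diff)
      qed
      finally show ?thesis .
    qed
  qed
  note bounded = this
  obtain n :: nat where "a \<le> real n" using real_arch_simple by blast
  then have "a \<le> 2 * real n" by simp
  then show ?thesis by (rule bounded[OF assms])
qed

section \<open>The cubic oscillator \<open>x'' = - x ^ 3\<close>\<close>

lemma cubic_oscillator_energy:
  fixes x x' :: "real \<Rightarrow> real"
  assumes "\<And>t. (x has_real_derivative x' t) (at t)" "\<And>t. (x' has_real_derivative - (x t ^ 3)) (at t)"
  shows "2 * (x' t)\<^sup>2 + x t ^ 4 = 2 * (x' 0)\<^sup>2 + x 0 ^ 4"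
proof -
  have "((\<lambda>t. 2 * (x' t)\<^sup>2 + x t ^ 4) has_vector_derivative 0) (at t)" for t
    unfolding has_vector_derivative_real
    by (auto intro!: derivative_eq_intros assms simp: algebra_simps)
  from vector_derivative_zero_constant[OF this, of t 0] show ?thesis .
qed

text \<open>The cube is not globally Lipschitz, but energy conservation confines both solutions to a
  bounded interval, where it is; a Gronwall estimate then applies.\<close>

lemma cubic_oscillator_unique:
  fixes x x' y y' :: "real \<Rightarrow> real"
  assumes x: "\<And>t. (x has_real_derivative x' t) (at t)" "\<And>t. (x' has_real_derivative - (x t ^ 3)) (at t)"
    and y: "\<And>t. (y has_real_derivative y' t) (at t)" "\<And>t. (y' has_real_derivative - (y t ^ 3)) (at t)"
    and init: "x 0 = y 0" "x' 0 = y' 0"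
  shows "x t = y t"
proof -
  \<comment> \<open>The common energy, by equality of the initial data. From
    \<open>u ^ 4 \<le> e\<close> follows \<open>\<bar>u\<bar> \<le> 1 + e\<close>, a crude bound
    that avoids roots.\<close>
  define e where "e = 2 * (x' 0)\<^sup>2 + x 0 ^ 4"
  have bound: "\<bar>u\<bar> \<le> 1 + e" if "2 * v\<^sup>2 + u ^ 4 = e" for u v
  proof (cases "\<bar>u\<bar> \<le> 1")
    case True
    have "e \<ge> 0" unfolding e_def by simp
    then show ?thesis using True by simp
  next
    case False
    then have "\<bar>u\<bar> ^ 1 \<le> \<bar>u\<bar> ^ 4" by (intro power_increasing) auto
    then have "\<bar>u\<bar> \<le> u ^ 4" by simp
    moreover have "u ^ 4 \<le> e" using that by (smt (verit) zero_le_power2)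
    ultimately show ?thesis by simp
  qed
  have bx: "\<bar>x t\<bar> \<le> 1 + e" for t
    using cubic_oscillator_energy[OF x, of t] by (intro bound[of "x' t"]) (simp add: e_def)
  have bdy: "\<bar>y t\<bar> \<le> 1 + e" for t
    using cubic_oscillator_energy[OF y, of t] by (intro bound[of "y' t"]) (simp add: e_def init)
  define D where "D t = (x t - y t)\<^sup>2 + (x' t - y' t)\<^sup>2" for t
  define D' where "D' t = 2 * (x t - y t) * (x' t - y' t) * (1 - ((x t)\<^sup>2 + x t * y t + (y t)\<^sup>2))" for t
  \<comment> \<open>Gronwall: \<open>\<bar>D'\<bar> \<le> K * D\<close> with \<open>D 0 = 0\<close> forces \<open>D = 0\<close>.\<close>
  define K where "K = 1 + 3 * (1 + e)\<^sup>2"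
  have dD: "(D has_real_derivative D' t) (at t)" for t
    unfolding D_def[abs_def] D'_def
    by (auto intro!: derivative_eq_intros x y simp: algebra_simps power2_eq_square power3_eq_cube)
  have D': "\<bar>D' t\<bar> \<le> K * D t" for t
  proof -
    have sq: "\<bar>u\<bar> * \<bar>v\<bar> \<le> (1 + e)\<^sup>2" if "\<bar>u\<bar> \<le> 1 + e" "\<bar>v\<bar> \<le> 1 + e" for u v
      unfolding power2_eq_square using that by (intro mult_mono) auto
    have "\<bar>1 - ((x t)\<^sup>2 + x t * y t + (y t)\<^sup>2)\<bar> \<le> 1 + \<bar>x t\<bar> * \<bar>x t\<bar> + \<bar>x t\<bar> * \<bar>y t\<bar> + \<bar>y t\<bar> * \<bar>y t\<bar>"
      unfolding abs_mult[symmetric] power2_eq_square by linarith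
    also have "\<dots> \<le> K"
      using sq[OF bx bx, of t t] sq[OF bx bdy, of t t] sq[OF bdy bdy, of t t] by (simp add: K_def)
    finally have 1: "\<bar>1 - ((x t)\<^sup>2 + x t * y t + (y t)\<^sup>2)\<bar> \<le> K" .
    have 2: "\<bar>2 * (x t - y t) * (x' t - y' t)\<bar> \<le> D t"
      using sum_squares_bound[of "\<bar>x t - y t\<bar>" "\<bar>x' t - y' t\<bar>"]
      unfolding D_def abs_mult abs_numeral power2_abs .
    show ?thesis
      unfolding D'_def abs_mult[of _ "1 - _"] using mult_mono[OF 1 2] by (simp add: K_def mult.commute)
  qed
  have D0: "D 0 = 0" by (simp add: D_def init)
  have "D t \<le> 0"
  \<comment> \<open>Forward in time \<open>D t * exp (- K * t)\<close> does not increase; backward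
    in time the other bound is needed, and \<open>D t * exp (K * t)\<close> does not
    decrease.\<close>
  proof (cases "t \<ge> 0")
    case True
    have "((\<lambda>t. D t * exp (- K * t)) has_real_derivative (D' t - K * D t) * exp (- K * t)) (at t)" for t
      by (auto intro!: derivative_eq_intros dD simp: algebra_simps)
    moreover have "(D' t - K * D t) * exp (- K * t) \<le> 0" for t
      using D'[of t] by (simp add: mult_le_0_iff)
    ultimately have "D t * exp (- K * t) \<le> D 0 * exp (- K * 0)"
      using DERIV_nonpos_imp_nonincreasing[OF True, of "\<lambda>t. D t * exp (- K * t)"] by blast
    then show ?thesis by (simp add: D0 mult_le_0_iff)
  next
    case False
    then have "t \<le> 0" by simp
    have "((\<lambda>t. D t * exp (K * t)) has_real_derivative (D' t + K * D t) * exp (K * t)) (at t)" for t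
      by (auto intro!: derivative_eq_intros dD simp: algebra_simps)
    moreover have "(D' t + K * D t) * exp (K * t) \<ge> 0" for t
      using D'[of t] by (simp add: zero_le_mult_iff)
    ultimately have "D t * exp (K * t) \<le> D 0 * exp (K * 0)"
      using DERIV_nonneg_imp_nondecreasing[OF \<open>t \<le> 0\<close>, of "\<lambda>t. D t * exp (K * t)"] by blast
    then show ?thesis by (simp add: D0 mult_le_0_iff)
  qed
  then show ?thesis unfolding D_def by (smt (verit) zero_le_power2 power_eq_0_iff)
qed

subsection \<open>Stationary solutions\<close>

lemma orthogonal_transformation_mult_sgn:
  "w \<noteq> 0 \<Longrightarrow> orthogonal_transformation (\<lambda>z. sgn w * z)" for w :: complex
  by (simp add: orthogonal_transformation norm_mult norm_sgn bounded_linear_mult_right bounded_linear.linear)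

lemma similarity_mult:
  assumes w: "w \<noteq> 0"
  shows "similarity (\<lambda>z. w * z + b)"
proof -
  have "(\<lambda>z. w * z + b) = (\<lambda>z. norm w *\<^sub>R (sgn w * z) + b)"
    using w by (simp add: sgn_div_norm)
  then show ?thesis
    unfolding similarity_def using w orthogonal_transformation_mult_sgn[OF w]
    by (intro exI[of _ "norm w"] exI[of _ "\<lambda>z. sgn w * z"]) auto
qed

lemma similarity_id: "similarity (\<lambda>z. z)"
  using similarity_mult[of 1 0] by simp

lemma similarity_scaleR: "r > 0 \<Longrightarrow> similarity (\<lambda>z. r *\<^sub>R z)"
  using similarity_mult[of "of_real r" 0] by (simp add: scaleR_conv_of_real)

text \<open>The equation survives by \<open>critical_transform\<close> with parameter change
  \<open>n * \<psi>\<close>; one turn of the parameter moves the base curve by \<open>n\<close>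
  periods, forwards or backwards according to the orientation of \<open>\<psi>\<close>.\<close>

lemma stationary_multiple_cover:
  assumes \<gamma>\<^sub>0: "stationary c \<gamma>\<^sub>0" and S: "similarity S" and m: "multiple_cover (S \<circ> \<gamma>\<^sub>0) \<gamma>"
  shows "stationary c \<gamma>"
proof -
  obtain n :: nat and \<psi> where n: "n \<ge> 1" and \<psi>: "circle_diffeo \<psi>"
    and \<gamma>: "\<gamma> = (\<lambda>t. S (\<gamma>\<^sub>0 (real n * \<psi> t)))"
    using m by (auto simp: multiple_cover_def)
  have d: "((\<lambda>t. real n * \<psi> t) has_vector_derivative real n * vector_derivative \<psi> (at t)) (at t)" for t
    using \<psi> by (auto simp: circle_diffeo_def intro!: derivative_eq_intros smooth_has_vector_derivative)
  have "critical c \<gamma>"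
    unfolding \<gamma>
  proof (rule critical_transform[OF _ _ _ S])
    show "critical c \<gamma>\<^sub>0" using \<gamma>\<^sub>0 by (simp add: stationary_iff_critical)
    show "smooth (\<lambda>t. real n * \<psi> t)"
      using \<psi> by (intro smooth_intros) (simp add: circle_diffeo_def)
    show "vector_derivative (\<lambda>t. real n * \<psi> t) (at t) \<noteq> 0" for t
      using n \<psi> unfolding vector_derivative_at[OF d] by (simp add: circle_diffeo_def)
  qed
  moreover have "\<gamma>\<^sub>0 (u + of_int k * (2 * pi)) = \<gamma>\<^sub>0 u" for u and k :: int
    using shift_of_int[of \<gamma>\<^sub>0 "2 * pi" 0 u k] \<gamma>\<^sub>0 by (simp add: stationary_iff_critical)
  from this[of _ "int n"] this[of _ "- int n"]
  have "\<gamma>\<^sub>0 (real n * (u + 2 * pi)) = \<gamma>\<^sub>0 (real n * u)" "\<gamma>\<^sub>0 (real n * (u - 2 * pi)) = \<gamma>\<^sub>0 (real n * u)" for u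
    by (simp_all add: algebra_simps)
  then have "\<gamma> (t + 2 * pi) = \<gamma> t" for t
    using \<psi> unfolding \<gamma> circle_diffeo_def by metis
  ultimately show ?thesis by (simp add: stationary_iff_critical)
qed

lemma arc_deriv_unit_speed:
  assumes "norm (vector_derivative \<gamma> (at t)) = 1" "(g has_vector_derivative g') (at t)"
  shows "arc_deriv \<gamma> g t = g'"
  using assms by (simp add: arc_deriv_def vector_derivative_at)

lemma critical_unit_speed:
  assumes i: "smooth \<gamma>" and u: "\<And>t. norm (vector_derivative \<gamma> (at t)) = 1"
    and k: "\<And>t. (curvature \<gamma> has_real_derivative k' t) (at t)"
      "\<And>t. (k' has_real_derivative - (c * curvature \<gamma> t ^ 3)) (at t)"
  shows "critical c \<gamma>"
proof -
  have "vector_derivative \<gamma> (at t) \<noteq> 0" for t using u[of t] by auto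
  then have "immersed \<gamma>" using i by (simp add: immersed_def)
  moreover have "arc_deriv \<gamma> (curvature \<gamma>) = k'"
    by (rule ext, rule arc_deriv_unit_speed[OF u]) (simp add: has_vector_derivative_real k)
  moreover have "arc_deriv \<gamma> k' t = - (c * curvature \<gamma> t ^ 3)" for t
    by (rule arc_deriv_unit_speed[OF u]) (simp add: has_vector_derivative_real k)
  ultimately show ?thesis by (simp add: critical_def)
qed

section \<open>Closed solutions parametrised by arclength\<close>

locale closed_critical_unit_speed =
  fixes c L :: real and \<Gamma> :: "real \<Rightarrow> complex"
  assumes L: "L > 0" and critical: "critical c \<Gamma>"
    and unit: "\<And>u. norm (vector_derivative \<Gamma> (at u)) = 1"
    and periodic: "\<And>u. \<Gamma> (u + L) = \<Gamma> u"

text \<open>The arclength \<open>s\<close> is an antiderivative of the speed. The speed is periodic,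
  so \<open>s\<close> is quasi-periodic and therefore bijective; its gain per turn is the length
  \<open>L\<close>, and \<open>\<Gamma>\<close> is \<open>\<gamma>\<close> composed with the inverse
  of \<open>s\<close>.\<close>

lemma stationary_arclength:
  assumes \<gamma>: "stationary c \<gamma>"
  obtains L \<Gamma> s where "closed_critical_unit_speed c L \<Gamma>" "smooth s" "\<And>t. vector_derivative s (at t) > 0"
    "\<And>t. s (t + 2 * pi) = s t + L" "\<gamma> = \<Gamma> \<circ> s"
proof -
  have crit: "critical c \<gamma>" and per: "\<And>t. \<gamma> (t + 2 * pi) = \<gamma> t"
    using \<gamma> by (auto simp: stationary_iff_critical)
  then have imm: "smooth \<gamma>" "\<And>t. vector_derivative \<gamma> (at t) \<noteq> 0" by (auto simp: critical_def immersed_def)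
  let ?v = "\<lambda>t. norm (vector_derivative \<gamma> (at t))"
  have sv: "smooth ?v" by (intro smooth_norm smooth_vector_derivative imm)
  then have "isCont ?v t" for t by (rule has_vector_derivative_continuous[OF smooth_has_vector_derivative])
  then obtain s where s: "\<And>t. (s has_vector_derivative ?v t) (at t)"
    using antiderivative_exists[of ?v] by blast
  have ss: "smooth s" by (rule smoothI[OF s sv])
  have shift: "s (t + 2 * pi) = s t + (s (2 * pi) - s 0)" for t
  proof -
    have "(\<gamma> has_vector_derivative vector_derivative \<gamma> (at (t + 2 * pi))) (at t)" for t
    proof -
      have "((\<lambda>t. t + 2 * pi) has_vector_derivative 1) (at t)" by (auto intro!: derivative_eq_intros)
      from vector_diff_chain_at[OF this smooth_has_vector_derivative[OF imm(1)]]
      show ?thesis by (simp add: o_def per)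
    qed
    then have v: "?v (t + 2 * pi) = ?v t" for t by (metis vector_derivative_at)
    have "((\<lambda>t. s (t + 2 * pi)) has_vector_derivative ?v t) (at t)" for t
    proof -
      have "((\<lambda>t. t + 2 * pi) has_vector_derivative 1) (at t)" by (auto intro!: derivative_eq_intros)
      from vector_diff_chain_at[OF this s] show ?thesis by (simp add: o_def v)
    qed
    from same_derivative_shift[OF this s, of t 0] show ?thesis by simp
  qed
  have dpos: "?v t > 0" for t using imm(2) by simp
  have sr: "(s has_real_derivative ?v t) (at t)" for t
    using s by (simp add: has_vector_derivative_real)
  have q: "0 < 2 * pi" by simp
  have bij: "bij s" and L: "s (2 * pi) - s 0 > 0"
    using bij_quasiperiodic[OF sr dpos q shift] by blast+
  have vs: "vector_derivative s (at t) = ?v t" for t by (rule vector_derivative_at[OF s])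
  have "line_diffeo s" using ss bij imm(2) by (simp add: line_diffeo_def vs)
  then have inv: "smooth (inv s)" "\<And>u. vector_derivative (inv s) (at u) \<noteq> 0"
    using line_diffeo_inv by (auto simp: line_diffeo_def)
  let ?\<Gamma> = "\<lambda>u. \<gamma> (inv s u)"
  have si: "s (inv s u) = u" "inv s (s u) = u" for u
    using bij by (simp_all add: bij_is_surj surj_f_inv_f bij_is_inj)
  have c: "critical c ?\<Gamma>"
    by (rule critical_transform[OF crit inv similarity_id])
  have "norm (vector_derivative ?\<Gamma> (at u)) = 1" for u
  proof -
    have "(inv s has_vector_derivative inverse (?v (inv s u))) (at u)"
      using inv_has_real_derivative[OF sr less_imp_neq[OF dpos, symmetric] bij]
      by (simp add: has_vector_derivative_real)
    from vector_diff_chain_at[OF this smooth_has_vector_derivative[OF imm(1)]]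
    show ?thesis using imm(2) by (simp add: o_def vector_derivative_at)
  qed
  moreover have "?\<Gamma> (u + (s (2 * pi) - s 0)) = ?\<Gamma> u" for u
  proof -
    have "s (inv s u + 2 * pi) = u + (s (2 * pi) - s 0)" using shift[of "inv s u"] by (simp add: si)
    then have "inv s (u + (s (2 * pi) - s 0)) = inv s u + 2 * pi" by (metis si(2))
    then show ?thesis by (simp add: per)
  qed
  moreover have "vector_derivative s (at t) > 0" for t unfolding vs by (rule dpos)
  moreover have "\<gamma> = ?\<Gamma> \<circ> s" by (simp add: si o_def)
  ultimately show ?thesis
    using that[of "s (2 * pi) - s 0" ?\<Gamma> s] L ss shift c
    by (simp add: closed_critical_unit_speed_def)
qed

lemma periodic_derivative:
  fixes f :: "real \<Rightarrow> 'a::real_normed_vector"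
  assumes "\<And>t. (f has_vector_derivative f' t) (at t)" "\<And>t. f (t + L) = f t"
  shows "f' (t + L) = f' t"
proof -
  have "((\<lambda>t. t + L) has_vector_derivative 1) (at t)" by (auto intro!: derivative_eq_intros)
  from vector_diff_chain_at[OF this assms(1)]
  have "(f has_vector_derivative f' (t + L)) (at t)" by (simp add: o_def assms(2))
  then show ?thesis using assms(1) by (rule vector_derivative_unique_at)
qed

text \<open>Both solutions rotate at the same rate, so \<open>T * cnj U\<close> is constant;
  multiplying by the unit vector \<open>U\<close> recovers \<open>T\<close>.\<close>

lemma same_phase_ode:
  assumes T: "\<And>t. (T has_vector_derivative k t *\<^sub>R (\<i> * T t)) (at t)"
    and U: "\<And>t. (U has_vector_derivative k t *\<^sub>R (\<i> * U t)) (at t)"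
    and n: "\<And>t. norm (U t) = 1"
  shows "T t = T 0 * cnj (U 0) * U t"
proof -
  have "((\<lambda>t. T t * cnj (U t)) has_vector_derivative 0) (at t)" for t
    using has_vector_derivative_mult[OF T has_vector_derivative_cnj[OF U], of t]
    by (simp add: algebra_simps)
  then have "T t * cnj (U t) = T 0 * cnj (U 0)" by (rule vector_derivative_zero_constant)
  moreover have "cnj (U t) * U t = 1"
    using complex_norm_square[of "U t"] by (simp add: n mult.commute)
  ultimately show ?thesis by (metis mult.assoc mult.right_neutral)
qed

context closed_critical_unit_speed
begin

abbreviation "T \<equiv> tangent \<Gamma>"
abbreviation "k \<equiv> curvature \<Gamma>"
abbreviation "k' \<equiv> (\<lambda>t. vector_derivative k (at t))"

lemma derivs:
  "(\<Gamma> has_vector_derivative T t) (at t)"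
  "(T has_vector_derivative k t *\<^sub>R (\<i> * T t)) (at t)"
  "norm (T t) = 1"
  "(k has_real_derivative k' t) (at t)"
  "(k' has_real_derivative - (c * k t ^ 3)) (at t)"
proof -
  have imm: "immersed \<Gamma>" using critical by (simp add: critical_def)
  show "(\<Gamma> has_vector_derivative T t) (at t)" "(T has_vector_derivative k t *\<^sub>R (\<i> * T t)) (at t)"
    "norm (T t) = 1"
    using immersed_frenet[OF imm] by (simp_all add: frenet_def unit)
  have sk: "smooth k" by (rule immersed_smooth[OF imm])
  show "(k has_real_derivative k' t) (at t)" by (rule smooth_has_real_derivative[OF sk])
  have 1: "arc_deriv \<Gamma> k = k'" by (simp add: arc_deriv_def fun_eq_iff unit)
  have "arc_deriv \<Gamma> k' t + c * k t ^ 3 = 0" using critical unfolding critical_def 1 by blast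
  then have "vector_derivative k' (at t) = - (c * k t ^ 3)" by (simp add: arc_deriv_def unit)
  then show "(k' has_real_derivative - (c * k t ^ 3)) (at t)"
    using smooth_has_real_derivative[OF smooth_vector_derivative[OF sk], of t] by simp
qed

lemma T_periodic: "T (u + L) = T u"
  using derivs(1) periodic by (rule periodic_derivative)

lemma k_periodic: "k (u + L) = k u"
proof -
  have "k (u + L) *\<^sub>R (\<i> * T (u + L)) = k u *\<^sub>R (\<i> * T u)"
    using derivs(2) T_periodic by (rule periodic_derivative)
  moreover have "T u \<noteq> 0" using derivs(3)[of u] by auto
  ultimately show ?thesis by (simp add: T_periodic)
qed

text \<open>With zero curvature the tangent is constant and the curve is a straight line, which
  cannot return after length \<open>L > 0\<close>.\<close>

lemma k_nonzero: "\<exists>u. k u \<noteq> 0"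
proof (rule ccontr)
  assume "\<not> ?thesis"
  then have "(T has_vector_derivative 0) (at t)" for t using derivs(2)[of t] by simp
  then have T: "T t = T 0" for t by (rule vector_derivative_zero_constant)
  have "(\<Gamma> has_vector_derivative T 0) (at t)" for t using derivs(1)[of t] T[of t] by simp
  moreover have "((\<lambda>t. t *\<^sub>R T 0) has_vector_derivative T 0) (at t)" for t
    by (auto intro!: derivative_eq_intros)
  ultimately have "\<Gamma> L - L *\<^sub>R T 0 = \<Gamma> 0 - 0 *\<^sub>R T 0" by (rule same_derivative_shift)
  then have "L *\<^sub>R T 0 = 0" using periodic[of 0] by simp
  then show False using L derivs(3)[of 0] by auto
qed

lemma nonpositive_parameter:
  assumes "c \<le> 0"
  shows "k u = k 0" "c = 0"
proof -
  define h where "h u = k u * k' u" for u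
  have dh: "(h has_real_derivative (k' u)\<^sup>2 - c * k u ^ 4) (at u)" for u
    unfolding h_def[abs_def]
    by (auto intro!: derivative_eq_intros derivs simp: power2_eq_square eval_nat_numeral algebra_simps)
  have k4: "- c * k u ^ 4 \<ge> 0" for u using assms by (intro mult_nonneg_nonneg) auto
  then have pos: "(k' u)\<^sup>2 - c * k u ^ 4 \<ge> 0" for u
    using k4[of u] zero_le_power2[of "k' u"] by linarith
  have mono: "h u \<le> h w" if "u \<le> w" for u w
    using dh pos by (intro DERIV_nonneg_imp_nondecreasing[OF that]) blast
  have "k' (u + L) = k' u" for u
    using derivs(4)[folded has_vector_derivative_real] k_periodic by (rule periodic_derivative)
  \<comment> \<open>The summand \<open>0\<close> puts periodicity into the form of
    \<open>shift_of_int\<close> with \<open>q = 0\<close>.\<close>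
  then have per: "h (u + L) = h u + 0" for u by (simp add: h_def k_periodic)
  \<comment> \<open>A monotone periodic function is constant: \<open>h w\<close> lies between
    \<open>h u\<close> and the value of \<open>h\<close> a whole number of periods after
    \<open>u\<close>. Its derivative, a sum of two nonnegative terms, then vanishes
    termwise.\<close>
  have eq: "h u = h w" if "u \<le> w" for u w
  proof -
    obtain n :: nat where "w - u < real n * L" using reals_Archimedean3[OF L] by blast
    then have "h w \<le> h (u + of_int (int n) * L)" by (intro mono) simp
    also have "\<dots> = h u" using shift_of_int[of h L 0 u "int n"] per by simp
    finally show ?thesis using mono[OF that] by simp
  qed
  have "h u = h 0" for u using eq[of u 0] eq[of 0 u] by linarith
  then have h: "h = (\<lambda>u. h 0)" by blast
  have "(k' u)\<^sup>2 - c * k u ^ 4 = 0" for u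
    using dh[of u] by (subst (asm) h) (rule DERIV_unique, assumption, rule DERIV_const)
  note energy = this
  have z: "(k' u)\<^sup>2 = 0 \<and> c * k u ^ 4 = 0" for u
    using k4[of u] zero_le_power2[of "k' u"] energy[of u] by (intro conjI; linarith)
  then have "(k has_vector_derivative 0) (at t)" for t
    using derivs(4)[of t] by (simp add: has_vector_derivative_real)
  then show "k u = k 0" by (rule vector_derivative_zero_constant)
  show "c = 0" using z k_nonzero by auto
qed

text \<open>Multiplying by \<open>sqrt c\<close> normalises the equation to
  \<open>x'' = - x ^ 3\<close>, whose solutions are invariant under replacing \<open>x u\<close> by
  \<open>A * x (A * u)\<close>. Amplitude and phase are matched to the initial data, and uniqueness
  does the rest.\<close>

lemma curvature_cn:
  assumes c: "c > 0"
  obtains A b where "A > 0" "\<And>u. k u = A / sqrt c * cn (A * u + b) (1 / 2)"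
proof -
  define x where "x u = sqrt c * k u" for u
  define x' where "x' u = sqrt c * k' u" for u
  have x: "(x has_real_derivative x' u) (at u)" "(x' has_real_derivative - (x u ^ 3)) (at u)" for u
  proof -
    show "(x has_real_derivative x' u) (at u)"
      unfolding x_def[abs_def] x'_def by (auto intro!: derivative_eq_intros derivs)
    have "sqrt c * - (c * k u ^ 3) = - (x u ^ 3)"
      using c by (simp add: x_def power3_eq_cube)
    then show "(x' has_real_derivative - (x u ^ 3)) (at u)"
      unfolding x'_def[abs_def] using DERIV_cmult[OF derivs(5)] by metis
  qed
  define e where "e = 2 * (x' 0)\<^sup>2 + x 0 ^ 4"
  note energy = cubic_oscillator_energy[OF x]
  have "e > 0"
  proof (rule ccontr)
    assume "\<not> e > 0"
    moreover have "2 * (x' u)\<^sup>2 + x u ^ 4 = e" for u unfolding e_def by (rule energy)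
    ultimately have "x u ^ 4 = 0" for u
      using zero_le_power2[of "x' u"] zero_le_even_power[of 4 "x u"] by (smt (verit) even_numeral)
    then show False using k_nonzero c by (auto simp: x_def)
  qed
  \<comment> \<open>The function \<open>A * cn (A * u + b)\<close> has energy \<open>A ^ 4\<close>,
    which forces the fourth root of \<open>e\<close>.\<close>
  define A where "A = sqrt (sqrt e)"
  have A: "A > 0" "A ^ 4 = e"
  proof -
    show "A > 0" using \<open>e > 0\<close> by (simp add: A_def)
    have "A ^ 4 = (A\<^sup>2)\<^sup>2" by simp
    also have "\<dots> = e" using \<open>e > 0\<close> by (simp add: A_def del: power_mult power2_eq_iff_nonneg)
    finally show "A ^ 4 = e" .
  qed
  \<comment> \<open>The initial data rescaled to energy \<open>1\<close>; the minus sign appears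
    because the derivative of \<open>cn\<close> is \<open>- sn * dn\<close>.\<close>
  have "2 * (- x' 0 / A\<^sup>2)\<^sup>2 + (x 0 / A) ^ 4 = (2 * (x' 0)\<^sup>2 + x 0 ^ 4) / A ^ 4"
    by (simp add: power_divide add_divide_distrib)
  also have "\<dots> = 1" using A \<open>e > 0\<close> by (simp add: e_def)
  finally obtain b where b: "cn b (1 / 2) = x 0 / A" "sn b * dn b = - x' 0 / A\<^sup>2"
    by (rule cn_phase_exists)
  have lin: "((\<lambda>u. A * u + b) has_real_derivative A) (at u)" for u
    by (auto intro!: derivative_eq_intros)
  define y where "y u = A * cn (A * u + b) (1 / 2)" for u
  define y' where "y' u = A * (A * - (sn (A * u + b) * dn (A * u + b)))" for u
  have y: "(y has_real_derivative y' u) (at u)" "(y' has_real_derivative - (y u ^ 3)) (at u)" for u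
  proof -
    have "(y has_real_derivative A * (- (sn (A * u + b) * dn (A * u + b)) * A)) (at u)"
      unfolding y_def[abs_def] by (rule DERIV_cmult[OF DERIV_chain2[OF cn_deriv lin]])
    then show "(y has_real_derivative y' u) (at u)" by (simp add: y'_def mult.commute)
    have "A * (A * (- (cn (A * u + b) (1 / 2) ^ 3) * A)) = - (y u ^ 3)"
      by (simp add: y_def power3_eq_cube)
    moreover have "(y' has_real_derivative A * (A * (- (cn (A * u + b) (1 / 2) ^ 3) * A))) (at u)"
      unfolding y'_def[abs_def]
      by (rule DERIV_cmult[OF DERIV_cmult[OF DERIV_chain2[OF sn_dn_deriv lin]]])
    ultimately show "(y' has_real_derivative - (y u ^ 3)) (at u)" by (simp only:)
  qed
  have "x 0 = y 0" using A(1) b(1) by (simp add: y_def)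
  moreover have "x' 0 = y' 0" using A(1) by (simp add: y'_def b(2) power2_eq_square)
  ultimately have "x u = y u" for u by (rule cubic_oscillator_unique[OF x y])
  then have "k u = A / sqrt c * cn (A * u + b) (1 / 2)" for u
    using c by (simp add: x_def y_def field_simps)
  with A(1) show ?thesis by (rule that)
qed

text \<open>The tangents of \<open>\<Gamma>\<close> and of the rescaled elastica obey the same phase
  equation, so they differ by a fixed rotation. Periodicity of the curvature makes
  \<open>A * L\<close> a whole number \<open>n\<close> of periods of \<open>cn\<close>, and
  closedness says that \<open>n\<close> displacements sum to zero.\<close>

lemma elastica_form:
  assumes c: "c > 0" and a: "a = 1 / sqrt (2 * c)"
  obtains A b w z n where "A > 0" "w \<noteq> 0" "(n::nat) \<ge> 1" "A * L = real n * cn_period"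
    "\<And>u. \<Gamma> u = w * elastica a (A * u + b) + z" "elastica a cn_period = 0"
proof -
  obtain A b where A: "A > 0" and k: "\<And>u. k u = A / sqrt c * cn (A * u + b) (1 / 2)"
    using curvature_cn[OF c] by blast
  have a2: "a * sqrt 2 = 1 / sqrt c" using c by (simp add: a real_sqrt_mult)
  have lin: "((\<lambda>u. A * u + b) has_vector_derivative A) (at u)" for u
    by (auto intro!: derivative_eq_intros)
  define U where "U u = cis (a * tilt (A * u + b))" for u
  have U: "(U has_vector_derivative k u *\<^sub>R (\<i> * U u)) (at u)" for u
  proof -
    have "A * (a * sqrt 2 * cn (A * u + b) (1 / 2)) = k u" unfolding k a2 by simp
    then show ?thesis
      using vector_diff_chain_at[OF lin cis_tilt_deriv, of a u] unfolding U_def[abs_def] o_def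
      by (simp add: scaleR_scaleR)
  qed
  \<comment> \<open>The rotation carrying \<open>U\<close> to \<open>T\<close>, divided by the speed
    \<open>A\<close> of the rescaled elastica.\<close>
  define w where "w = T 0 * cnj (U 0) / of_real A"
  have "norm (U u) = 1" for u by (simp add: U_def)
  note phase = same_phase_ode[OF derivs(2) U this]
  have T: "T u = w * (A *\<^sub>R U u)" for u
    unfolding phase[of u] using A by (simp add: w_def scaleR_conv_of_real)
  have w0: "w \<noteq> 0" using T[of 0] derivs(3)[of 0] by auto
  have "((\<lambda>u. w * elastica a (A * u + b)) has_vector_derivative T u) (at u)" for u
    unfolding T U_def using vector_diff_chain_at[OF lin elastica_deriv, of a u]
    by (intro has_vector_derivative_mult_right) (simp add: o_def)
  from same_derivative_shift[OF derivs(1) this, of _ 0]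
  have \<Gamma>: "\<Gamma> u = w * elastica a (A * u + b) + (\<Gamma> 0 - w * elastica a b)" for u
    by (simp add: algebra_simps)
  have "cn (s + A * L) (1 / 2) = cn s (1 / 2)" for s
  proof -
    have "A * ((s - b) / A) + b = s" "A * ((s - b) / A + L) + b = s + A * L"
      using A by (simp_all add: distrib_left)
    then show ?thesis using k_periodic[of "(s - b) / A"] A c by (simp add: k)
  qed
  then obtain m :: int where m: "A * L = of_int m * cn_period" by (rule cn_shift_imp_multiple)
  have "m > 0"
    using m A L cn_period_pos by (metis mult_pos_pos of_int_0_less_iff zero_less_mult_pos2)
  have "elastica a (b + of_int m * cn_period) = elastica a b + of_int m *\<^sub>R elastica a cn_period"
    by (rule shift_of_int) (rule elastica_shift)
  moreover have "elastica a (b + of_int m * cn_period) = elastica a b"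
    using \<Gamma>[of L] \<Gamma>[of 0] periodic[of 0] w0 m by (simp add: add.commute)
  ultimately have "elastica a cn_period = 0" using \<open>m > 0\<close> by simp
  then show ?thesis using that[OF A w0 _ _ \<Gamma>, of "nat m"] \<open>m > 0\<close> m by simp
qed

text \<open>Constant curvature makes the tangent rotate uniformly. The integer \<open>m\<close> is
  the rotation index, negative for clockwise circles.\<close>

lemma circle_form:
  assumes "c = 0"
  obtains \<kappa> r \<beta> p and m :: int where "r > 0" "\<kappa> \<noteq> 0" "m \<noteq> 0" "\<kappa> * L = 2 * pi * of_int m"
    "\<And>u. \<Gamma> u = round_circle p r (\<kappa> * u + \<beta>)"
proof -
  define \<kappa> where "\<kappa> = k 0"
  have k: "k u = \<kappa>" for u using nonpositive_parameter(1) assms by (simp add: \<kappa>_def)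
  have \<kappa>: "\<kappa> \<noteq> 0" using k_nonzero by (simp add: k)
  have lin: "((\<lambda>u. \<kappa> * u) has_real_derivative \<kappa>) (at u)" for u
    by (auto intro!: derivative_eq_intros)
  note U = has_vector_derivative_cis[OF lin]
  have T: "T u = T 0 * cis (\<kappa> * u)" for u
    using same_phase_ode[OF derivs(2)[unfolded k] U, of u] by simp
  define q where "q = T 0 / (\<i> * of_real \<kappa>)"
  have q0: "q \<noteq> 0" using \<kappa> derivs(3)[of 0] by (auto simp: q_def)
  have "((\<lambda>u. q * cis (\<kappa> * u)) has_vector_derivative T u) (at u)" for u
  proof -
    have "((\<lambda>u. q * cis (\<kappa> * u)) has_vector_derivative q * (\<kappa> *\<^sub>R (\<i> * cis (\<kappa> * u)))) (at u)"
      by (rule has_vector_derivative_mult_right[OF U])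
    moreover have "q * (\<kappa> *\<^sub>R (\<i> * cis (\<kappa> * u))) = T u"
      using \<kappa> unfolding T[of u] by (simp add: q_def scaleR_conv_of_real mult.left_commute[of "T 0" \<i>])
    ultimately show ?thesis by simp
  qed
  from same_derivative_shift[OF derivs(1) this, of _ 0]
  have \<Gamma>: "\<Gamma> u = (\<Gamma> 0 - q) + q * cis (\<kappa> * u)" for u by (simp add: algebra_simps)
  have qp: "q = of_real (norm q) * cis (Arg q)" using rcis_cmod_Arg[of q] by (simp add: rcis_def)
  have \<Gamma>c: "\<Gamma> u = round_circle (\<Gamma> 0 - q) (norm q) (\<kappa> * u + Arg q)" for u
  proof -
    have "q * cis (\<kappa> * u) = norm q *\<^sub>R cis (\<kappa> * u + Arg q)"
      by (subst qp) (simp add: scaleR_conv_of_real cis_mult add.commute)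
    then show ?thesis using \<Gamma>[of u] by (simp add: round_circle_def)
  qed
  have "cis (\<kappa> * L) = 1" using \<Gamma>[of L] \<Gamma>[of 0] periodic[of 0] q0 by simp
  then have "cos (\<kappa> * L) = 1" by (simp add: complex_eq_iff)
  then obtain m :: int where m: "\<kappa> * L = of_int m * 2 * pi" unfolding cos_one_2pi_int by blast
  then have "m \<noteq> 0" using \<kappa> L by auto
  then show ?thesis using that[OF _ \<kappa> _ _ \<Gamma>c, of m] q0 m by simp
qed

end

section \<open>Circles and the parameter \<open>c = 0\<close>\<close>

lemma stationary_circle:
  assumes "r > 0"
  shows "stationary 0 (round_circle p r)"
proof -
  have d: "(cis has_vector_derivative (\<i> * cis t)) (at t)" for t
    using has_vector_derivative_cis[of "\<lambda>t. t" 1 t] by simp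
  have F: "frenet (round_circle p r) (\<lambda>t. r) (\<lambda>t. \<i> * cis t) (\<lambda>t. 1 / r)"
    using assms d by (auto simp: frenet_def round_circle_def[abs_def] norm_mult intro!: derivative_eq_intros)
  have "smooth (round_circle p r)"
    unfolding round_circle_def[abs_def] by (intro smooth_intros smooth_cis)
  moreover have "vector_derivative (round_circle p r) (at t) \<noteq> 0" for t
  proof -
    have "(round_circle p r has_vector_derivative r *\<^sub>R (\<i> * cis t)) (at t)"
      using F by (simp add: frenet_def)
    from vector_derivative_at[OF this] show ?thesis using assms by simp
  qed
  ultimately have "immersed (round_circle p r)" by (simp add: immersed_def)
  then show ?thesis
    unfolding stationary_iff_critical critical_def frenet_curvature[OF F]
    by (simp add: arc_deriv_def[abs_def] round_circle_def cis_mult[symmetric])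
qed

lemma stationary_0_iff:
  "stationary 0 \<gamma> \<longleftrightarrow> (\<exists>p r. r > 0 \<and> multiple_cover (round_circle p r) \<gamma>)"
proof
  assume "stationary 0 \<gamma>"
  then obtain L s \<Gamma> where \<Gamma>: "closed_critical_unit_speed 0 L \<Gamma>" and s: "smooth s"
    "\<And>t. vector_derivative s (at t) > 0" "\<And>t. s (t + 2 * pi) = s t + L" and \<gamma>: "\<gamma> = \<Gamma> \<circ> s"
    using stationary_arclength by blast
  interpret closed_critical_unit_speed 0 L \<Gamma> by (rule \<Gamma>)
  obtain \<kappa> r \<beta> p and m :: int where *: "r > 0" "\<kappa> \<noteq> 0" "m \<noteq> 0" "\<kappa> * L = 2 * pi * of_int m"
    "\<And>u. \<Gamma> u = round_circle p r (\<kappa> * u + \<beta>)" by (rule circle_form[OF refl]) (rule that)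
  define n where "n = nat \<bar>m\<bar>"
  have n: "n \<ge> 1" "real n = \<bar>of_int m\<bar>" using \<open>m \<noteq> 0\<close> by (auto simp: n_def)
  \<comment> \<open>The polar angle divided by the number of turns, so that one period of
    \<open>t\<close> changes \<open>\<psi>\<close> by \<open>2 * pi\<close> with the sign of
    \<open>m\<close>: clockwise circles are covered by orientation-reversing
    \<open>\<psi>\<close>.\<close>
  define \<psi> where "\<psi> t = (\<kappa> * s t + \<beta>) * inverse (real n)" for t
  have d: "(\<psi> has_vector_derivative \<kappa> * vector_derivative s (at t) * inverse (real n)) (at t)" for t
    unfolding \<psi>_def[abs_def]
    by (auto intro!: derivative_eq_intros smooth_has_vector_derivative s)
  have sh: "\<psi> (t + 2 * pi) = \<psi> t + 2 * pi * (of_int m / \<bar>of_int m\<bar>)" for t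
  proof -
    have "\<kappa> * s (t + 2 * pi) = \<kappa> * s t + 2 * pi * of_int m"
      unfolding s(3) using *(4) by (simp add: distrib_left)
    then show ?thesis unfolding \<psi>_def n(2) by (simp add: algebra_simps divide_inverse)
  qed
  have "circle_diffeo \<psi>"
    unfolding circle_diffeo_def
  proof (intro conjI allI)
    show "smooth \<psi>" unfolding \<psi>_def[abs_def] by (intro smooth_intros s)
    show "vector_derivative \<psi> (at t) \<noteq> 0" for t
      using n *(2) s(2)[of t] unfolding vector_derivative_at[OF d] by simp
    show "(\<forall>t. \<psi> (t + 2 * pi) = \<psi> t + 2 * pi) \<or> (\<forall>t. \<psi> (t + 2 * pi) = \<psi> t - 2 * pi)"
      unfolding sh using *(3) by (cases "m > 0") auto
  qed
  moreover have "\<gamma> = (\<lambda>t. round_circle p r (real n * \<psi> t))"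
  proof -
    have "real n * \<psi> t = \<kappa> * s t + \<beta>" for t
      using n(1) by (simp add: \<psi>_def mult.left_commute[of "real n"])
    then show ?thesis by (simp add: \<gamma> o_def *(5))
  qed
  ultimately have "multiple_cover (round_circle p r) \<gamma>"
    unfolding multiple_cover_def using n(1) by blast
  then show "\<exists>p r. r > 0 \<and> multiple_cover (round_circle p r) \<gamma>" using *(1) by blast
next
  assume "\<exists>p r. r > 0 \<and> multiple_cover (round_circle p r) \<gamma>"
  then obtain p r where "r > 0" "multiple_cover ((\<lambda>z. z) \<circ> round_circle p r) \<gamma>" by (auto simp: o_def)
  then show "stationary 0 \<gamma>"
    using stationary_multiple_cover[OF stationary_circle similarity_id] by blast
qed

section \<open>Positive parameters and super-lemniscates\<close>

lemma stationary_elastica_form: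
  assumes "stationary c \<gamma>" "c > 0" "a = 1 / sqrt (2 * c)"
  obtains w z \<rho> n where "w \<noteq> 0" "(n::nat) \<ge> 1" "smooth \<rho>" "\<And>t. vector_derivative \<rho> (at t) > 0"
    "\<And>t. \<rho> (t + 2 * pi) = \<rho> t + real n * cn_period" "\<gamma> = (\<lambda>t. w * elastica a (\<rho> t) + z)"
    "elastica a cn_period = 0"
proof -
  from assms(1) obtain L s \<Gamma> where \<Gamma>: "closed_critical_unit_speed c L \<Gamma>" and s: "smooth s"
    "\<And>t. vector_derivative s (at t) > 0" "\<And>t. s (t + 2 * pi) = s t + L" and \<gamma>: "\<gamma> = \<Gamma> \<circ> s"
    using stationary_arclength by blast
  interpret closed_critical_unit_speed c L \<Gamma> by (rule \<Gamma>)
  obtain A b w z n where *: "A > 0" "w \<noteq> 0" "(n::nat) \<ge> 1" "A * L = real n * cn_period"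
    "\<And>u. \<Gamma> u = w * elastica a (A * u + b) + z" "elastica a cn_period = 0"
    by (rule elastica_form[OF assms(2,3)]) (rule that)
  have d: "((\<lambda>t. A * s t + b) has_vector_derivative A * vector_derivative s (at t)) (at t)" for t
    by (auto intro!: derivative_eq_intros smooth_has_vector_derivative s)
  show ?thesis
  proof (rule that[of w n "\<lambda>t. A * s t + b" z])
    show "smooth (\<lambda>t. A * s t + b)" by (intro smooth_intros s)
    show "vector_derivative (\<lambda>t. A * s t + b) (at t) > 0" for t
      unfolding vector_derivative_at[OF d] using *(1) s(2) by simp
    show "A * s (t + 2 * pi) + b = A * s t + b + real n * cn_period" for t
      unfolding s(3) using *(4) by (simp add: distrib_left)
  qed (use * \<gamma> in \<open>auto simp: o_def\<close>)
qed

lemma smooth_elastica: "smooth (elastica a)"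
  by (rule smoothI[OF elastica_deriv smooth_compose[OF smooth_cis]]) (intro smooth_intros smooth_tilt)

lemma critical_elastica:
  assumes "c > 0" "a = 1 / sqrt (2 * c)"
  shows "critical c (elastica a)"
proof (rule critical_unit_speed[OF smooth_elastica])
  have K: "curvature (elastica a) = (\<lambda>s. a * sqrt 2 * cn s (1 / 2))"
    by (rule frenet_curvature[OF elastica_frenet])
  show "norm (vector_derivative (elastica a) (at t)) = 1" for t
    by (simp add: vector_derivative_at[OF elastica_deriv])
  show "(curvature (elastica a) has_real_derivative a * sqrt 2 * - (sn t * dn t)) (at t)" for t
    unfolding K by (rule DERIV_cmult[OF cn_deriv])
  have "a * sqrt 2 * - (cn t (1 / 2) ^ 3) = - (c * curvature (elastica a) t ^ 3)" for t
  proof -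
    \<comment> \<open>This identity makes the amplitude \<open>a * sqrt 2\<close> of the curvature
      the correct one for the cubic term.\<close>
    have "c * (a * sqrt 2)\<^sup>2 = 1" using assms by (simp add: power_mult_distrib power_divide)
    then have "a * sqrt 2 = c * (a * sqrt 2) ^ 3" by (simp add: power3_eq_cube power2_eq_square)
    then show ?thesis unfolding K power_mult_distrib[of "a * sqrt 2"] by simp
  qed
  then show "((\<lambda>t. a * sqrt 2 * - (sn t * dn t)) has_real_derivative - (c * curvature (elastica a) t ^ 3)) (at t)" for t
    using DERIV_cmult[OF sn_dn_deriv, of "a * sqrt 2" t] by simp
qed

lemma stationary_closed_elastica:
  assumes "c > 0" "a = 1 / sqrt (2 * c)" "elastica a cn_period = 0"
  shows "stationary c (\<lambda>t. elastica a (cn_period / (2 * pi) * t))"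
  unfolding stationary_iff_critical
proof
  have d: "((\<lambda>t. cn_period / (2 * pi) * t) has_vector_derivative cn_period / (2 * pi)) (at t)" for t
    by (auto intro!: derivative_eq_intros)
  show "critical c (\<lambda>t. elastica a (cn_period / (2 * pi) * t))"
    using cn_period_pos vector_derivative_at[OF d]
    by (intro critical_transform[OF critical_elastica[OF assms(1,2)] _ _ similarity_id] smooth_intros) auto
  show "\<forall>t. elastica a (cn_period / (2 * pi) * (t + 2 * pi)) = elastica a (cn_period / (2 * pi) * t)"
    using elastica_shift[of a] assms(3) by (simp add: ring_distribs)
qed

text \<open>Uniqueness: every solution traverses a similar copy of the one-period elastica, and the
  number of periods of \<open>cn\<close> it runs through is the covering number.\<close>

lemma stationary_iff_cover_elastica:
  assumes "c > 0" "a = 1 / sqrt (2 * c)" "elastica a cn_period = 0"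
  shows "stationary c \<gamma> \<longleftrightarrow> (\<exists>S. similarity S \<and>
    multiple_cover (S \<circ> (\<lambda>t. elastica a (cn_period / (2 * pi) * t))) \<gamma>)" (is "_ \<longleftrightarrow> ?R")
proof
  assume "stationary c \<gamma>"
  then obtain w z \<rho> n where *: "w \<noteq> 0" "(n::nat) \<ge> 1" "smooth \<rho>" "\<And>t. vector_derivative \<rho> (at t) > 0"
    "\<And>t. \<rho> (t + 2 * pi) = \<rho> t + real n * cn_period" "\<gamma> = (\<lambda>t. w * elastica a (\<rho> t) + z)"
    by (rule stationary_elastica_form[OF _ assms(1,2)]) (rule that)
  \<comment> \<open>Normalises the gain of \<open>\<rho>\<close> over one turn to
    \<open>2 * pi\<close>; the factors \<open>n\<close> and \<open>cn_period / (2 * pi)\<close> then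
    restore \<open>\<rho>\<close>.\<close>
  define C where "C = 2 * pi / (real n * cn_period)"
  have C: "C > 0" "C * (real n * cn_period) = 2 * pi" "cn_period / (2 * pi) * (real n * (C * x)) = x" for x
    using *(2) cn_period_pos by (auto simp: C_def)
  have d: "((\<lambda>t. C * \<rho> t) has_vector_derivative C * vector_derivative \<rho> (at t)) (at t)" for t
    by (auto intro!: derivative_eq_intros smooth_has_vector_derivative *)
  have "circle_diffeo (\<lambda>t. C * \<rho> t)"
    unfolding circle_diffeo_def
  proof (intro conjI allI)
    show "smooth (\<lambda>t. C * \<rho> t)" by (intro smooth_intros *)
    show "vector_derivative (\<lambda>t. C * \<rho> t) (at t) \<noteq> 0" for t
      using C(1) *(4)[of t] unfolding vector_derivative_at[OF d] by simp
    show "(\<forall>t. C * \<rho> (t + 2 * pi) = C * \<rho> t + 2 * pi) \<or> (\<forall>t. C * \<rho> (t + 2 * pi) = C * \<rho> t - 2 * pi)"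
      unfolding *(5) using C(2) by (simp add: distrib_left)
  qed
  then have "multiple_cover ((\<lambda>z'. w * z' + z) \<circ> (\<lambda>t. elastica a (cn_period / (2 * pi) * t))) \<gamma>"
    unfolding multiple_cover_def using *(2)
    by (intro exI[of _ n] exI[of _ "\<lambda>t. C * \<rho> t"] conjI) (simp_all only: *(6) o_def C(3))
  then show ?R using similarity_mult[OF *(1)] by blast
next
  assume ?R
  then show "stationary c \<gamma>"
    using stationary_multiple_cover[OF stationary_closed_elastica[OF assms]] by blast
qed

lemma c_crit_pos: "j \<ge> 1 \<Longrightarrow> c_crit j > 0"
  by (auto simp: c_crit_def)

lemma eq_c_crit_iff:
  assumes "c > 0" "j \<ge> 1"
  shows "c = c_crit j \<longleftrightarrow> 1 / sqrt (2 * c) = (4 * real j - 1) / 2"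
proof -
  have p: "4 * real j - 1 > 0" using assms(2) by simp
  have "1 / sqrt (2 * c) = (4 * real j - 1) / 2 \<longleftrightarrow> sqrt (2 * c) = 2 / (4 * real j - 1)"
    using p assms(1) by (auto simp: field_simps)
  also have "\<dots> \<longleftrightarrow> 2 * c = (2 / (4 * real j - 1))\<^sup>2"
    using p assms(1) by (metis abs_of_pos divide_pos_pos less_imp_le mult_pos_pos real_sqrt_abs real_sqrt_pow2 zero_less_numeral)
  also have "\<dots> \<longleftrightarrow> c = c_crit j" by (auto simp: c_crit_def power_divide)
  finally show ?thesis by simp
qed

lemma elastica_c_crit_closed:
  assumes "j \<ge> 1"
  shows "elastica (1 / sqrt (2 * c_crit j)) cn_period = 0"
  using eq_c_crit_iff[OF c_crit_pos[OF assms] assms] elastica_closed_iff[of "1 / sqrt (2 * c_crit j)"]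
    c_crit_pos[OF assms] assms by auto

text \<open>Forwards, undoing the parameter change and dividing by \<open>norm w\<close> leaves a
  rotated and translated unit-speed elastica, with the required curvature. Backwards, that curvature
  solves the equation, which survives undoing the scaling and the reparametrisation.\<close>

lemma stationary_iff_super_lemniscate:
  assumes j: "j \<ge> 1"
  shows "stationary (c_crit j) \<gamma> \<longleftrightarrow> super_lemniscate j \<gamma>"
proof
  define c where "c = c_crit j"
  have c: "c > 0" unfolding c_def by (rule c_crit_pos[OF j])
  define a where "a = 1 / sqrt (2 * c)"
  have a2: "a * sqrt 2 = 1 / sqrt c" using c by (simp add: a_def real_sqrt_mult)
  {
    assume st: "stationary (c_crit j) \<gamma>"
    then obtain w z \<rho> n where *: "w \<noteq> 0" "(n::nat) \<ge> 1" "smooth \<rho>" "\<And>t. vector_derivative \<rho> (at t) > 0"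
      "\<And>t. \<rho> (t + 2 * pi) = \<rho> t + real n * cn_period" "\<gamma> = (\<lambda>t. w * elastica a (\<rho> t) + z)"
      by (rule stationary_elastica_form[OF _ c_crit_pos[OF j] a_def[unfolded c_def]]) (rule that)
    have "0 < 2 * pi" by simp
    from bij_quasiperiodic(1)[OF smooth_has_real_derivative[OF *(3)] *(4) this *(5)]
    have bij: "bij \<rho>" .
    then have "line_diffeo \<rho>" using *(3,4) less_imp_neq by (fastforce simp: line_diffeo_def)
    then have inv: "line_diffeo (inv \<rho>)" by (rule line_diffeo_inv)
    have "\<rho> (inv \<rho> u) = u" for u using bij by (simp add: bij_is_surj surj_f_inv_f)
    then have \<eta>: "(\<lambda>s. inverse (norm w) *\<^sub>R \<gamma> (inv \<rho> s)) =
        (\<lambda>s. 1 *\<^sub>R (sgn w * elastica a s) + inverse (norm w) *\<^sub>R z)"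
      by (simp add: *(6) sgn_div_norm scaleR_add_right)
    have o: "orthogonal_transformation (\<lambda>z. sgn w * z)"
      by (rule orthogonal_transformation_mult_sgn[OF *(1)])
    have F: "frenet (\<lambda>s. inverse (norm w) *\<^sub>R \<gamma> (inv \<rho> s)) (\<lambda>s. 1)
        (\<lambda>s. sgn w * cis (a * tilt s)) (\<lambda>s. a * sqrt 2 * cn s (1 / 2))"
      unfolding \<eta>
      using frenet_transform[OF elastica_frenet, of "\<lambda>s. s" "\<lambda>s. 1" 1 "\<lambda>z. sgn w * z" 1 1, OF _ _ _ _ o]
      by simp
    have "norm (vector_derivative (\<lambda>s. inverse (norm w) *\<^sub>R \<gamma> (inv \<rho> s)) (at s)) = 1 \<and>
      curvature (\<lambda>s. inverse (norm w) *\<^sub>R \<gamma> (inv \<rho> s)) s = 1 / sqrt (c_crit j) * cn s (1 / 2)" for s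
    proof
      have "((\<lambda>s. inverse (norm w) *\<^sub>R \<gamma> (inv \<rho> s)) has_vector_derivative sgn w * cis (a * tilt s)) (at s)"
        using F by (simp add: frenet_def)
      from vector_derivative_at[OF this]
      show "norm (vector_derivative (\<lambda>s. inverse (norm w) *\<^sub>R \<gamma> (inv \<rho> s)) (at s)) = 1"
        using *(1) by (simp add: norm_mult norm_sgn)
      show "curvature (\<lambda>s. inverse (norm w) *\<^sub>R \<gamma> (inv \<rho> s)) s = 1 / sqrt (c_crit j) * cn s (1 / 2)"
        unfolding frenet_curvature[OF F] a2 c_def ..
    qed
    moreover have "closed_immersed \<gamma>" using st by (simp add: stationary_def)
    ultimately show "super_lemniscate j \<gamma>"
      unfolding super_lemniscate_def using inv *(1)
      by (intro conjI exI[of _ "inverse (norm w)"] exI[of _ "inv \<rho>"]) auto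
  next
    assume "super_lemniscate j \<gamma>"
    then obtain r \<phi> where \<gamma>: "closed_immersed \<gamma>" and r: "r > 0" and \<phi>: "line_diffeo \<phi>"
      and u: "\<And>s. norm (vector_derivative (\<lambda>s. r *\<^sub>R \<gamma> (\<phi> s)) (at s)) = 1"
      and k: "\<And>s. curvature (\<lambda>s. r *\<^sub>R \<gamma> (\<phi> s)) s = 1 / sqrt c * cn s (1 / 2)"
      by (auto simp: super_lemniscate_def c_def)
    let ?\<eta> = "\<lambda>s. r *\<^sub>R \<gamma> (\<phi> s)"
    have K: "curvature ?\<eta> = (\<lambda>s. 1 / sqrt c * cn s (1 / 2))" using k by blast
    have "critical c ?\<eta>"
    proof (rule critical_unit_speed[OF _ u])
      show "smooth ?\<eta>"
        using \<gamma> \<phi> by (intro smooth_intros smooth_compose[of \<gamma> \<phi>])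
          (auto simp: closed_immersed_def immersed_def line_diffeo_def)
      show "(curvature ?\<eta> has_real_derivative 1 / sqrt c * - (sn t * dn t)) (at t)" for t
        unfolding K by (rule DERIV_cmult[OF cn_deriv])
      have "1 / sqrt c * - (cn t (1 / 2) ^ 3) = - (c * (1 / sqrt c * cn t (1 / 2)) ^ 3)" for t
        using c by (simp add: power_mult_distrib power3_eq_cube field_simps)
      then show "((\<lambda>t. 1 / sqrt c * - (sn t * dn t)) has_real_derivative - (c * curvature ?\<eta> t ^ 3)) (at t)" for t
        unfolding K using DERIV_cmult[OF sn_dn_deriv, of "1 / sqrt c" t] by simp
    qed
    moreover have "line_diffeo (inv \<phi>)" by (rule line_diffeo_inv[OF \<phi>])
    ultimately have "critical c (\<lambda>t. inverse r *\<^sub>R ?\<eta> (inv \<phi> t))"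
      using r by (intro critical_transform[where S = "\<lambda>z. inverse r *\<^sub>R z"] similarity_scaleR)
        (auto simp: line_diffeo_def)
    moreover have "(\<lambda>t. inverse r *\<^sub>R ?\<eta> (inv \<phi> t)) = \<gamma>"
      using r \<phi> by (simp add: line_diffeo_def bij_is_surj surj_f_inv_f)
    ultimately show "stationary (c_crit j) \<gamma>"
      using \<gamma> by (simp add: stationary_iff_critical closed_immersed_def c_def)
  }
qed

lemma stationary_exists_iff:
  "(\<exists>\<gamma>. stationary c \<gamma>) \<longleftrightarrow> c = 0 \<or> (\<exists>j\<ge>1. c = c_crit j)"
proof
  assume "\<exists>\<gamma>. stationary c \<gamma>"
  then obtain \<gamma> where \<gamma>: "stationary c \<gamma>" by blast
  show "c = 0 \<or> (\<exists>j\<ge>1. c = c_crit j)"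
  proof (cases "c > 0")
    \<comment> \<open>For positive \<open>c\<close> the closing condition on
      \<open>1 / sqrt (2 * c)\<close> selects the critical values.\<close>
    case True
    have "elastica (1 / sqrt (2 * c)) cn_period = 0"
      using stationary_elastica_form[OF \<gamma> True refl] by blast
    then obtain j :: nat where "j \<ge> 1" "1 / sqrt (2 * c) = (4 * real j - 1) / 2"
      using True elastica_closed_iff[of "1 / sqrt (2 * c)"] by auto
    then show ?thesis using eq_c_crit_iff[OF True] by blast
  next
    case False
    obtain L \<Gamma> where "closed_critical_unit_speed c L \<Gamma>"
      using stationary_arclength[OF \<gamma>] by blast
    then interpret closed_critical_unit_speed c L \<Gamma> .
    show ?thesis using False nonpositive_parameter(2) by simp
  qed
next
  assume "c = 0 \<or> (\<exists>j\<ge>1. c = c_crit j)"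
  then show "\<exists>\<gamma>. stationary c \<gamma>"
    using stationary_circle[of 1 0] stationary_closed_elastica[OF c_crit_pos refl elastica_c_crit_closed]
    by fastforce
qed

theorem theorem1p1:
  shows "(\<forall>c::real. (\<exists>\<gamma>. stationary c \<gamma>) \<longleftrightarrow> c = 0 \<or> (\<exists>j\<ge>1. c = c_crit j)) \<and>
    (\<forall>\<gamma>. stationary 0 \<gamma> \<longleftrightarrow> (\<exists>p r. r > 0 \<and> multiple_cover (round_circle p r) \<gamma>)) \<and>
    (\<forall>j\<ge>1.
       (\<forall>\<gamma>. stationary (c_crit j) \<gamma> \<longleftrightarrow> super_lemniscate j \<gamma>) \<and>
       (\<exists>\<gamma>\<^sub>0. super_lemniscate j \<gamma>\<^sub>0 \<and>
          (\<forall>\<gamma>. stationary (c_crit j) \<gamma> \<longleftrightarrow>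
             (\<exists>S. similarity S \<and> multiple_cover (S \<circ> \<gamma>\<^sub>0) \<gamma>))))"
proof (intro conjI allI impI)
  fix j :: nat
  assume j: "j \<ge> 1"
  \<comment> \<open>The base curve runs through exactly one period of \<open>cn\<close> as
    \<open>t\<close> runs through \<open>2 * pi\<close>.\<close>
  let ?\<gamma>\<^sub>0 = "\<lambda>t. elastica (1 / sqrt (2 * c_crit j)) (cn_period / (2 * pi) * t)"
  note c = c_crit_pos[OF j] refl elastica_c_crit_closed[OF j]
  show "\<exists>\<gamma>\<^sub>0. super_lemniscate j \<gamma>\<^sub>0 \<and> (\<forall>\<gamma>. stationary (c_crit j) \<gamma> \<longleftrightarrow>
      (\<exists>S. similarity S \<and> multiple_cover (S \<circ> \<gamma>\<^sub>0) \<gamma>))"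
    using stationary_closed_elastica[OF c] stationary_iff_cover_elastica[OF c]
    unfolding stationary_iff_super_lemniscate[OF j] by (intro exI[of _ ?\<gamma>\<^sub>0]) blast
qed (use stationary_exists_iff stationary_0_iff stationary_iff_super_lemniscate in auto)

end
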